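(* For every $n\ge1$, $\dim\mathcal{W}_n=2n(3n+1)$.
   Context: $\mathbb{H}$ is the division ring of real quaternions and $M_n(\mathbb{H})$ is the space of $n\times n$ quaternionic matrices, a real vector space of dimension $4n^2$. $\mathcal{W}_n$ is the set of all pairs $(A,B)\in M_n(\mathbb{H})\times M_n(\mathbb{H})$ that are simultaneously triangularizable, i.e. for which there is $P\in\mathrm{GL}_n(\mathbb{H})$ such that $PAP^{-1}$ and $PBP^{-1}$ are both upper triangular. It is a semi-algebraic set, and $\dim$ denotes its (real) dimension as a semi-algebraic set. *)

theory Defs
  imports Complex_Main "Jordan_Normal_Form.Matrix"
begin

section \<open>Real quaternions\<close>

datatype quat = Quat (qRe: real) (qI: real) (qJ: real) (qK: real)

lemma quat_eq_iff:
  "x = y \<longleftrightarrow> qRe x = qRe y \<and> qI x = qI y \<and> qJ x = qJ y \<and> qK x = qK y"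
  by (cases x; cases y) auto

instantiation quat :: division_ring
begin

definition zero_quat :: quat where "0 = Quat 0 0 0 0"
definition one_quat :: quat where "1 = Quat 1 0 0 0"
definition plus_quat :: "quat \<Rightarrow> quat \<Rightarrow> quat" where
  "x + y = Quat (qRe x + qRe y) (qI x + qI y) (qJ x + qJ y) (qK x + qK y)"
definition uminus_quat :: "quat \<Rightarrow> quat" where
  "- x = Quat (- qRe x) (- qI x) (- qJ x) (- qK x)"
definition minus_quat :: "quat \<Rightarrow> quat \<Rightarrow> quat" where
  "x - y = Quat (qRe x - qRe y) (qI x - qI y) (qJ x - qJ y) (qK x - qK y)"
definition times_quat :: "quat \<Rightarrow> quat \<Rightarrow> quat" where
  "x * y = Quat
     (qRe x * qRe y - qI x * qI y - qJ x * qJ y - qK x * qK y)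
     (qRe x * qI y + qI x * qRe y + qJ x * qK y - qK x * qJ y)
     (qRe x * qJ y - qI x * qK y + qJ x * qRe y + qK x * qI y)
     (qRe x * qK y + qI x * qJ y - qJ x * qI y + qK x * qRe y)"
definition inverse_quat :: "quat \<Rightarrow> quat" where
  "inverse x = (let N = (qRe x)\<^sup>2 + (qI x)\<^sup>2 + (qJ x)\<^sup>2 + (qK x)\<^sup>2
     in Quat (qRe x / N) (- qI x / N) (- qJ x / N) (- qK x / N))"
definition divide_quat :: "quat \<Rightarrow> quat \<Rightarrow> quat" where
  "x div y = x * inverse (y :: quat)"

lemma quat_norm_pos:
  assumes "x \<noteq> (0 :: quat)"
  shows "(qRe x)\<^sup>2 + (qI x)\<^sup>2 + (qJ x)\<^sup>2 + (qK x)\<^sup>2 > 0"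
proof -
  have "qRe x \<noteq> 0 \<or> qI x \<noteq> 0 \<or> qJ x \<noteq> 0 \<or> qK x \<noteq> 0"
    using assms by (auto simp: quat_eq_iff zero_quat_def)
  then show ?thesis
    by (smt (verit) zero_le_power2 zero_less_power2)
qed

instance
proof
  fix x y z :: quat
  show "x + y + z = x + (y + z)" by (simp add: plus_quat_def)
  show "x + y = y + x" by (simp add: plus_quat_def)
  show "0 + x = x" by (simp add: plus_quat_def zero_quat_def)
  show "- x + x = 0" by (simp add: plus_quat_def uminus_quat_def zero_quat_def)
  show "x - y = x + - y" by (simp add: plus_quat_def uminus_quat_def minus_quat_def)
  show "x * y * z = x * (y * z)" by (simp add: times_quat_def algebra_simps)
  show "1 * x = x" by (simp add: times_quat_def one_quat_def)
  show "x * 1 = x" by (simp add: times_quat_def one_quat_def)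
  show "(x + y) * z = x * z + y * z"
    by (simp add: times_quat_def plus_quat_def algebra_simps)
  show "x * (y + z) = x * y + x * z"
    by (simp add: times_quat_def plus_quat_def algebra_simps)
  show "(0 :: quat) \<noteq> 1" by (simp add: zero_quat_def one_quat_def)
  show "x div y = x * inverse y" by (simp add: divide_quat_def)
  show "inverse (0 :: quat) = 0" by (simp add: inverse_quat_def zero_quat_def)
  assume "x \<noteq> 0"
  define N where "N = (qRe x)\<^sup>2 + (qI x)\<^sup>2 + (qJ x)\<^sup>2 + (qK x)\<^sup>2"
  have inv: "inverse x = Quat (qRe x / N) (- qI x / N) (- qJ x / N) (- qK x / N)"
    by (simp add: inverse_quat_def N_def Let_def)
  have "N \<noteq> 0"
    using quat_norm_pos[OF \<open>x \<noteq> 0\<close>] by (simp add: N_def)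
  then have one: "(qRe x * qRe x + qI x * qI x + qJ x * qJ x + qK x * qK x) / N = 1"
    by (simp add: N_def power2_eq_square)
  show "inverse x * x = 1" "x * inverse x = 1"
    using one unfolding inv
    by (simp_all add: times_quat_def one_quat_def add_divide_distrib mult.commute)
qed

end

section \<open>Simultaneously triangularizable pairs\<close>

text \<open>The matrix \<open>Q\<close> is the inverse of \<open>P\<close>; both equations are required, so that
  \<open>P\<close> is invertible in the ring of \<open>n \<times> n\<close> matrices.\<close>

definition simul_triang :: "nat \<Rightarrow> (quat mat \<times> quat mat) set" where
  "simul_triang n = {(A, B). A \<in> carrier_mat n n \<and> B \<in> carrier_mat n n \<and>
     (\<exists>P \<in> carrier_mat n n. \<exists>Q \<in> carrier_mat n n.
        P * Q = 1\<^sub>m n \<and> Q * P = 1\<^sub>m n \<and>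
        upper_triangular (P * A * Q) \<and> upper_triangular (P * B * Q))}"

section \<open>Real coordinates\<close>

definition quat_coord :: "quat \<Rightarrow> nat \<Rightarrow> real" where
  "quat_coord q c = [qRe q, qI q, qJ q, qK q] ! c"

text \<open>The coordinates of a matrix are listed row by row, four consecutive ones for each
  entry, which identifies the space of \<open>n \<times> n\<close> matrices with the real vectors of
  length \<open>4 n\<^sup>2\<close>.\<close>

definition mat_coords :: "nat \<Rightarrow> quat mat \<Rightarrow> real vec" where
  "mat_coords n A =
     vec (4 * n\<^sup>2) (\<lambda>k. quat_coord (A $$ (k div 4 div n, k div 4 mod n)) (k mod 4))"

definition pair_coords :: "nat \<Rightarrow> quat mat \<times> quat mat \<Rightarrow> real vec" where
  "pair_coords n = (\<lambda>(A, B). mat_coords n A @\<^sub>v mat_coords n B)"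

section \<open>Semi-algebraic sets and their dimension\<close>

inductive_set poly_fun :: "nat \<Rightarrow> (real vec \<Rightarrow> real) set" for m :: nat where
  const: "(\<lambda>x. c) \<in> poly_fun m"
| coord: "i < m \<Longrightarrow> (\<lambda>x. x $ i) \<in> poly_fun m"
| add: "p \<in> poly_fun m \<Longrightarrow> q \<in> poly_fun m \<Longrightarrow> (\<lambda>x. p x + q x) \<in> poly_fun m"
| mult: "p \<in> poly_fun m \<Longrightarrow> q \<in> poly_fun m \<Longrightarrow> (\<lambda>x. p x * q x) \<in> poly_fun m"

text \<open>Algebraic sets need no clause of their own: \<open>p = 0\<close> is the complement of
  \<open>p > 0 \<or> - p > 0\<close>.\<close>

inductive semialgebraic :: "nat \<Rightarrow> real vec set \<Rightarrow> bool" for m :: nat where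
  pos: "p \<in> poly_fun m \<Longrightarrow> semialgebraic m {x \<in> carrier_vec m. p x > 0}"
| union: "semialgebraic m S \<Longrightarrow> semialgebraic m T \<Longrightarrow> semialgebraic m (S \<union> T)"
| inter: "semialgebraic m S \<Longrightarrow> semialgebraic m T \<Longrightarrow> semialgebraic m (S \<inter> T)"
| compl: "semialgebraic m S \<Longrightarrow> semialgebraic m (carrier_vec m - S)"

definition open_cube :: "nat \<Rightarrow> real vec set" where
  "open_cube d = {x \<in> carrier_vec d. \<forall>i<d. 0 < x $ i \<and> x $ i < 1}"

text \<open>A map is semi-algebraic if its graph is; continuity is not required.\<close>

definition semialgebraic_map ::
    "nat \<Rightarrow> nat \<Rightarrow> real vec set \<Rightarrow> real vec set \<Rightarrow> (real vec \<Rightarrow> real vec) \<Rightarrow> bool" where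
  "semialgebraic_map d m X Y f \<longleftrightarrow>
     X \<subseteq> carrier_vec d \<and> Y \<subseteq> carrier_vec m \<and> f ` X \<subseteq> Y \<and>
     semialgebraic (d + m) ((\<lambda>x. x @\<^sub>v f x) ` X)"

text \<open>The dimension of a semi-algebraic subset \<open>S\<close> of real \<open>m\<close>-space, as in Basu, Pollack
  and Roy, \<^emph>\<open>Algorithms in Real Algebraic Geometry\<close>: the largest \<open>d\<close> for which there is an
  injective semi-algebraic map from the open \<open>d\<close>-cube to \<open>S\<close>, and \<open>-1\<close> if \<open>S\<close> is empty.
  The 0-cube is a point, so every nonempty \<open>S\<close> admits such a map for \<open>d = 0\<close>, and
  \<open>d \<le> m\<close> for every such map, so the maximum exists.\<close>

definition semialgebraic_dim :: "nat \<Rightarrow> real vec set \<Rightarrow> int" where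
  "semialgebraic_dim m S =
     (if S = {} then - 1
      else int (Max {d. \<exists>f. semialgebraic_map d m (open_cube d) S f \<and> inj_on f (open_cube d)}))"

section \<open>Basic facts about the encodings\<close>

lemma semialgebraic_zero_set:
  assumes "p \<in> poly_fun m"
  shows "semialgebraic m {x \<in> carrier_vec m. p x = 0}"
proof -
  have "(\<lambda>x. (- 1) * p x) \<in> poly_fun m"
    using poly_fun.mult[OF poly_fun.const[of "- 1"] assms] by simp
  from semialgebraic.compl[OF semialgebraic.union[OF
        semialgebraic.pos[OF assms] semialgebraic.pos[OF this]]]
  have "semialgebraic m (carrier_vec m -
      ({x \<in> carrier_vec m. p x > 0} \<union> {x \<in> carrier_vec m. (- 1) * p x > 0}))" .
  also have "carrier_vec m -
      ({x \<in> carrier_vec m. p x > 0} \<union> {x \<in> carrier_vec m. (- 1) * p x > 0}) =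
      {x \<in> carrier_vec m. p x = 0}" by auto
  finally show ?thesis .
qed

lemma mat_coords_index:
  assumes "i < n" "j < n" "c < 4"
  shows "4 * (i * n + j) + c < 4 * n\<^sup>2"
    and "mat_coords n A $ (4 * (i * n + j) + c) = quat_coord (A $$ (i, j)) c"
proof -
  have "i * n + j < n * n"
    using mult_le_mono1[of "Suc i" n n] assms by simp
  then show less: "4 * (i * n + j) + c < 4 * n\<^sup>2"
    using assms by (simp add: power2_eq_square)
  have "(4 * (i * n + j) + c) div 4 = i * n + j" "(4 * (i * n + j) + c) mod 4 = c"
    using assms div_mult_self4[of 4 "i * n + j" c] mod_mult_self4[of 4 "i * n + j" c]
    by (simp_all del: distrib_left_numeral add_mult_distrib2)
  moreover have "(i * n + j) div n = i" "(i * n + j) mod n = j"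
    using assms by simp_all
  ultimately show "mat_coords n A $ (4 * (i * n + j) + c) = quat_coord (A $$ (i, j)) c"
    using less by (simp add: mat_coords_def)
qed

lemma quat_coord_simps [simp]:
  "quat_coord q 0 = qRe q" "quat_coord q (Suc 0) = qI q"
  "quat_coord q 2 = qJ q" "quat_coord q 3 = qK q"
  by (simp_all add: quat_coord_def numeral_2_eq_2 numeral_3_eq_3)

lemma mat_coords_bij: "bij_betw (mat_coords n) (carrier_mat n n) (carrier_vec (4 * n\<^sup>2))"
proof (rule bij_betwI')
  fix A B :: "quat mat" assume AB: "A \<in> carrier_mat n n" "B \<in> carrier_mat n n"
  show "mat_coords n A = mat_coords n B \<longleftrightarrow> A = B"
  proof
    assume eq: "mat_coords n A = mat_coords n B"
    show "A = B"
    proof (rule eq_matI)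
      fix i j assume "i < dim_row B" "j < dim_col B"
      then have ij: "i < n" "j < n" using AB by auto
      have "quat_coord (A $$ (i, j)) c = quat_coord (B $$ (i, j)) c" if "c < 4" for c
        
        using mat_coords_index(2)[OF ij that, of A] mat_coords_index(2)[OF ij that, of B] eq by simp
      from this[of 0] this[of 1] this[of 2] this[of 3]
      show "A $$ (i, j) = B $$ (i, j)" by (simp add: quat_eq_iff)
    qed (use AB in auto)
  qed simp
next
  fix A :: "quat mat"
  show "mat_coords n A \<in> carrier_vec (4 * n\<^sup>2)" by (simp add: mat_coords_def)
next
  fix v :: "real vec" assume v: "v \<in> carrier_vec (4 * n\<^sup>2)"
  define A where "A = mat n n (\<lambda>(i, j). let k = 4 * (i * n + j)
    in Quat (v $ k) (v $ (k + 1)) (v $ (k + 2)) (v $ (k + 3)))"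
  have "mat_coords n A = v"
  proof (rule eq_vecI)
    fix k assume "k < dim_vec v"
    then have k: "k < 4 * n\<^sup>2" using v by simp
    then have n: "n > 0" by (cases n) auto
    have d: "k div 4 < n * n" using k
      by (intro less_mult_imp_div_less) (simp add: power2_eq_square)
    define i j where "i = k div 4 div n" and "j = k div 4 mod n"
    have i: "i < n" using d by (simp add: i_def less_mult_imp_div_less)
    have j: "j < n" using n by (simp add: j_def)
    have "i * n + j = k div 4" by (simp add: i_def j_def)
    then have k_eq: "4 * (i * n + j) + k mod 4 = k" by simp
    have "mat_coords n A $ (4 * (i * n + j) + k mod 4) = quat_coord (A $$ (i, j)) (k mod 4)"
      by (rule mat_coords_index(2)) (use i j in simp_all)
    also have "\<dots> = v $ (4 * (i * n + j) + k mod 4)"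
    proof -
      have "A $$ (i, j) = (let l = 4 * (i * n + j)
        in Quat (v $ l) (v $ (l + 1)) (v $ (l + 2)) (v $ (l + 3)))"
        using i j by (simp add: A_def)
      moreover have "k mod 4 = 0 \<or> k mod 4 = 1 \<or> k mod 4 = 2 \<or> k mod 4 = 3" by arith
      ultimately show ?thesis 
        by (elim disjE) (simp_all add: Let_def)
    qed
    finally show "mat_coords n A $ k = v $ k" by (simp only: k_eq)
  qed (use v in \<open>simp add: mat_coords_def\<close>)
  moreover have "A \<in> carrier_mat n n" by (simp add: A_def)
  ultimately show "\<exists>A \<in> carrier_mat n n. v = mat_coords n A" by metis
qed

lemma coords_length: "4 * n\<^sup>2 + 4 * n\<^sup>2 = 8 * (n :: nat)\<^sup>2"
  by linarith

lemma mat_coords_carrier: "mat_coords n A \<in> carrier_vec (4 * n\<^sup>2)"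
  by (simp add: mat_coords_def)

lemma pair_coords_bij:
  "bij_betw (pair_coords n) (carrier_mat n n \<times> carrier_mat n n) (carrier_vec (8 * n\<^sup>2))"
proof (rule bij_betwI')
  fix X Y :: "quat mat \<times> quat mat"
  assume "X \<in> carrier_mat n n \<times> carrier_mat n n" "Y \<in> carrier_mat n n \<times> carrier_mat n n"
  then obtain A B A' B' where XY: "X = (A, B)" "Y = (A', B')"
    and m: "A \<in> carrier_mat n n" "B \<in> carrier_mat n n"
      "A' \<in> carrier_mat n n" "B' \<in> carrier_mat n n"
    by blast
  note inj = inj_on_eq_iff[OF bij_betw_imp_inj_on[OF mat_coords_bij[of n]]]
  show "pair_coords n X = pair_coords n Y \<longleftrightarrow> X = Y"
    unfolding XY pair_coords_def prod.case prod.inject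
      append_vec_eq[OF mat_coords_carrier mat_coords_carrier]
      inj[OF m(1,3)] inj[OF m(2,4)] by (rule refl)
next
  fix X :: "quat mat \<times> quat mat"
  show "pair_coords n X \<in> carrier_vec (8 * n\<^sup>2)"
    using append_carrier_vec[OF mat_coords_carrier[of n "fst X"] mat_coords_carrier[of n "snd X"]]
    unfolding pair_coords_def case_prod_beta coords_length .
next
  fix v :: "real vec" assume "v \<in> carrier_vec (8 * n\<^sup>2)"
  then have v: "v \<in> carrier_vec (4 * n\<^sup>2 + 4 * n\<^sup>2)"
    unfolding coords_length .
  have surj: "mat_coords n ` carrier_mat n n = carrier_vec (4 * n\<^sup>2)"
    by (rule bij_betw_imp_surj_on[OF mat_coords_bij])
  have "vec_first v (4 * n\<^sup>2) \<in> mat_coords n ` carrier_mat n n"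
    unfolding surj by (rule vec_first_carrier)
  then obtain A where A: "vec_first v (4 * n\<^sup>2) = mat_coords n A" "A \<in> carrier_mat n n"
    by (rule imageE)
  have "vec_last v (4 * n\<^sup>2) \<in> mat_coords n ` carrier_mat n n"
    unfolding surj by (rule vec_last_carrier)
  then obtain B where B: "vec_last v (4 * n\<^sup>2) = mat_coords n B" "B \<in> carrier_mat n n"
    by (rule imageE)
  have v_eq: "v = pair_coords n (A, B)"
    unfolding pair_coords_def prod.case A(1)[symmetric] B(1)[symmetric]
    by (rule vec_first_last_append[OF v, symmetric])
  show "\<exists>X \<in> carrier_mat n n \<times> carrier_mat n n. v = pair_coords n X"
    by (rule bexI, rule v_eq, rule SigmaI[OF A(2) B(2)])
qed

end

theory Submission
  imports Defs "HOL-Library.Countable_Set" "HOL-Library.More_List"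
    "HOL-Analysis.Continuum_Not_Denumerable" "Jordan_Normal_Form.Determinant"
begin

text \<open>Upper bound: column reduction of the conjugating matrix, with pivot rows chosen freely, writes
  the entries of a pair in \<open>simul_triang n\<close> as integer polynomials in \<open>D = 2n(3n + 1)\<close> real
  parameters: the entries of a lower unitriangular and of two upper triangular matrices. Let \<open>f\<close> be
  an injective semi-algebraic map from the open \<open>d\<close>-cube, \<open>x\<close> a point of the cube with
  coordinates algebraically independent over the constants defining the graph of \<open>f\<close>, and \<open>t\<close>
  parameters of \<open>f x\<close>. Every vector at \<open>x\<close> extends to a Zariski tangent vector at the generic
  point \<open>(x, t)\<close>. If \<open>d > D\<close>, then by linear algebra some tangent vector vanishes on \<open>t\<close>, hence on
  \<open>f x\<close>, but not on \<open>x\<close>; so \<open>x\<close> is not algebraic over \<open>f x\<close>. Then \<open>x\<close> can be moved slightly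
  while finitely many equations between \<open>x\<close> and \<open>f x\<close> are kept, the remaining conditions that
  define the graph being open, and this contradicts injectivity.

  Lower bound: \<open>(L, T, U)\<close> is mapped to \<open>(L T L\<^sup>-\<^sup>1, L U L\<^sup>-\<^sup>1)\<close>, where the diagonal entries of \<open>T\<close> have
  increasing real parts. Then \<open>L\<close> is determined by its image, because conjugate quaternions have
  equal real parts.\<close>

section \<open>Integer polynomials and algebraic elements\<close>

text \<open>Expressions are kept as syntax because the same one is evaluated over the reals and over
  the dual numbers, and because there are only countably many of them. Real coefficients enter later
  as values of further variables.\<close>

datatype pexp = PC int | PV nat | PA pexp pexp | PM pexp pexp

instance pexp :: countable
  by countable_datatype

primrec peval :: "pexp \<Rightarrow> (nat \<Rightarrow> 'a) \<Rightarrow> 'a :: comm_ring_1" where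
  "peval (PC k) \<rho> = of_int k"
| "peval (PV i) \<rho> = \<rho> i"
| "peval (PA p q) \<rho> = peval p \<rho> + peval q \<rho>"
| "peval (PM p q) \<rho> = peval p \<rho> * peval q \<rho>"

primrec psubst :: "(nat \<Rightarrow> pexp) \<Rightarrow> pexp \<Rightarrow> pexp" where
  "psubst \<sigma> (PC k) = PC k"
| "psubst \<sigma> (PV i) = \<sigma> i"
| "psubst \<sigma> (PA p q) = PA (psubst \<sigma> p) (psubst \<sigma> q)"
| "psubst \<sigma> (PM p q) = PM (psubst \<sigma> p) (psubst \<sigma> q)"

lemma peval_psubst: "peval (psubst \<sigma> p) \<rho> = peval p (\<lambda>i. peval (\<sigma> i) \<rho>)"
  by (induction p) auto

abbreviation pev :: "pexp \<Rightarrow> 'a list \<Rightarrow> 'a :: comm_ring_1" where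
  "pev p xs \<equiv> peval p (nth_default 0 xs)"

text \<open>A list of expressions is read as the list of coefficients, lowest degree first, of a polynomial
  in one further variable.\<close>

primrec last_eval :: "pexp list \<Rightarrow> 'a list \<Rightarrow> 'a \<Rightarrow> 'a :: comm_ring_1" where
  "last_eval [] xs y = 0"
| "last_eval (r # rs) xs y = pev r xs + y * last_eval rs xs y"

fun coeffs_add :: "pexp list \<Rightarrow> pexp list \<Rightarrow> pexp list" where
  "coeffs_add [] ss = ss"
| "coeffs_add rs [] = rs"
| "coeffs_add (r # rs) (s # ss) = PA r s # coeffs_add rs ss"

lemma last_eval_coeffs_add: "last_eval (coeffs_add rs ss) xs y = last_eval rs xs y + last_eval ss xs y"
  by (induction rs ss rule: coeffs_add.induct) (auto simp: algebra_simps)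

lemma length_coeffs_add: "length (coeffs_add rs ss) = max (length rs) (length ss)"
  by (induction rs ss rule: coeffs_add.induct) auto

lemma last_eval_scale: "last_eval (map (PM r) rs) xs y = pev r xs * last_eval rs xs y"
  by (induction rs) (auto simp: algebra_simps)

lemma last_eval_snoc: "last_eval (rs @ [r]) xs y = last_eval rs xs y + pev r xs * y ^ length rs"
  by (induction rs) (auto simp: algebra_simps)

lemma last_eval_zero: "\<forall>r\<in>set rs. pev r xs = 0 \<Longrightarrow> last_eval rs xs y = 0"
  by (induction rs) auto

primrec coeffs_mult :: "pexp list \<Rightarrow> pexp list \<Rightarrow> pexp list" where
  "coeffs_mult [] ss = []"
| "coeffs_mult (r # rs) ss = coeffs_add (map (PM r) ss) (PC 0 # coeffs_mult rs ss)"

lemma last_eval_coeffs_mult: "last_eval (coeffs_mult rs ss) xs y = last_eval rs xs y * last_eval ss xs y"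
  by (induction rs) (auto simp: last_eval_coeffs_add last_eval_scale algebra_simps)

text \<open>Variable \<open>N\<close> becomes the main variable. A variable above \<open>N\<close>
  stays a coefficient: in \<open>last_eval_last_coeffs\<close>, where \<open>xs\<close> has length
  \<open>N\<close>, it takes the default value 0 on both sides.\<close>

primrec last_coeffs :: "nat \<Rightarrow> pexp \<Rightarrow> pexp list" where
  "last_coeffs N (PC k) = [PC k]"
| "last_coeffs N (PV i) = (if i = N then [PC 0, PC 1] else [PV i])"
| "last_coeffs N (PA p q) = coeffs_add (last_coeffs N p) (last_coeffs N q)"
| "last_coeffs N (PM p q) = coeffs_mult (last_coeffs N p) (last_coeffs N q)"

lemma last_eval_last_coeffs: "last_eval (last_coeffs (length xs) p) xs y = pev p (xs @ [y])"
  by (induction p) (auto simp: last_eval_coeffs_add last_eval_coeffs_mult nth_default_append nth_default_def nth_append)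

text \<open>Pseudo-division by \<open>ms\<close>, evaluated at zeros of \<open>ms\<close>, where the quotient drops out.\<close>

lemma pseudo_remainder:
  assumes "length ms = Suc n" "n \<ge> 1"
  shows "\<exists>E ss. length ss = n \<and> (\<forall>xs (y :: 'a :: comm_ring_1). last_eval ms xs y = 0 \<longrightarrow>
           pev (last ms) xs ^ E * last_eval rs xs y = last_eval ss xs y)"
proof (induction rs)
  case Nil
  show ?case
    by (rule exI[of _ 0], rule exI[of _ "replicate n (PC 0)"]) (auto intro!: last_eval_zero)
next
  case (Cons r rs)
  then obtain E ss where ss: "length ss = n"
    and red: "\<And>xs (y :: 'a). last_eval ms xs y = 0 \<Longrightarrow>
           pev (last ms) xs ^ E * last_eval rs xs y = last_eval ss xs y" by blast
  define c where "c = last ms"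
  define l where "l = last ss"
  have ss_eq: "ss = butlast ss @ [l]" and ms_eq: "ms = butlast ms @ [c]"
    using ss assms by (auto simp: l_def c_def intro!: append_butlast_last_id[symmetric])
  have lens: "length (butlast ss) = n - 1" "length (butlast ms) = n" using ss assms by auto
  define cE where "cE = (PM c ^^ Suc E) (PC 1)"
  have foldE: "pev ((PM c ^^ k) (PC 1)) xs = pev c xs ^ k" for k and xs :: "'a list"
    by (induction k) auto
  \<comment> \<open>Multiplying the remainder \<open>ss\<close> by \<open>y\<close> creates a term
    \<open>l * y ^ n\<close>. One more factor \<open>c\<close> allows \<open>c * y ^ n\<close> to be
    replaced by the lower terms of \<open>ms\<close>, so the length stays \<open>n\<close>.\<close>
  define ts where "ts = coeffs_add [PM cE r] (coeffs_add (map (PM c) (PC 0 # butlast ss))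
     (map (PM (PM (PC (-1)) l)) (butlast ms)))"
  have "length ts = n" using assms lens by (auto simp: ts_def length_coeffs_add)
  moreover have "pev (last ms) xs ^ Suc E * last_eval (r # rs) xs y = last_eval ts xs y"
    if 0: "last_eval ms xs y = 0" for xs and y :: 'a
  proof -
    have 1: "pev c xs * y ^ n = - last_eval (butlast ms) xs y"
      using 0 lens(2) last_eval_snoc[of "butlast ms" c xs y] ms_eq
      by (metis add.commute eq_neg_iff_add_eq_0)
    have 2: "last_eval ss xs y = last_eval (butlast ss) xs y + pev l xs * y ^ (n - 1)"
      using lens(1) last_eval_snoc[of "butlast ss" l xs y] ss_eq by metis
    have yn: "y * y ^ (n - 1) = y ^ n" using assms(2) by (cases n) auto
    have "pev c xs ^ Suc E * last_eval (r # rs) xs y =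
        pev c xs ^ Suc E * pev r xs + pev c xs * y * (pev c xs ^ E * last_eval rs xs y)"
      by (simp add: algebra_simps)
    also have "\<dots> = pev c xs ^ Suc E * pev r xs + pev c xs * y * last_eval ss xs y"
      using red[OF 0] by (simp add: c_def)
    also have "pev c xs * y * last_eval ss xs y =
        pev c xs * y * last_eval (butlast ss) xs y + pev l xs * (pev c xs * (y * y ^ (n - 1)))"
      unfolding 2 by (simp add: algebra_simps)
    also have "\<dots> = pev c xs * y * last_eval (butlast ss) xs y - pev l xs * last_eval (butlast ms) xs y"
      unfolding yn 1 by simp
    finally show ?thesis
      unfolding ts_def last_eval_coeffs_add last_eval_scale cE_def
      by (simp add: foldE c_def[symmetric] algebra_simps last_eval_scale)
  qed
  ultimately show ?case by blast
qed

text \<open>Product rule: the derivative of \<open>r + y * q\<close> is \<open>q + y * q'\<close>.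
  The result is exactly one shorter than a nonempty input, so the derivative of a minimal polynomial
  falls below the minimal length.\<close>

primrec deriv_coeffs :: "pexp list \<Rightarrow> pexp list" where
  "deriv_coeffs [] = []"
| "deriv_coeffs (r # rs) = (if rs = [] then [] else map2 PA rs (PC 0 # deriv_coeffs rs))"

lemma length_deriv_coeffs: "length (deriv_coeffs rs) = length rs - 1"
  by (induction rs) (auto simp: Suc_diff_le)

lemma last_eval_map2_PA:
  "length rs = length ss \<Longrightarrow> last_eval (map2 PA rs ss) xs y = last_eval rs xs y + last_eval ss xs y"
  by (induction rs ss rule: list_induct2) (auto simp: algebra_simps)

lemma last_eval_deriv_coeffs_Cons: "last_eval (deriv_coeffs (r # rs)) xs y = last_eval rs xs y + y * last_eval (deriv_coeffs rs) xs y"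
proof (cases rs)
  case (Cons s ss)
  then have "length rs > 0" by simp
  then have "length rs = length (PC 0 # deriv_coeffs rs)" using length_deriv_coeffs[of rs] by (simp del: length_greater_0_conv)
  from last_eval_map2_PA[OF this, of xs y] have "last_eval (map2 PA rs (PC 0 # deriv_coeffs rs)) xs y =
    last_eval rs xs y + last_eval (PC 0 # deriv_coeffs rs) xs y" .
  moreover have "rs \<noteq> []" using Cons by simp
  ultimately show ?thesis by simp
qed auto

text \<open>Over the reals the integer factor is nonzero, so a nonvanishing leading coefficient
  survives differentiation.\<close>

lemma pev_last_deriv_coeffs:
  "length rs \<ge> 2 \<Longrightarrow> pev (last (deriv_coeffs rs)) xs = of_nat (length rs - 1) * pev (last rs) xs"
proof (induction rs)
  case (Cons r rs)
  then have ne: "rs \<noteq> []" by auto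
  show ?case
  proof (cases "length rs \<ge> 2")
    case True
    have len: "length rs = length (PC 0 # deriv_coeffs rs)" using ne by (simp add: length_deriv_coeffs)
    have "deriv_coeffs rs \<noteq> []" using True length_deriv_coeffs[of rs] by auto
    then have "last (deriv_coeffs (r # rs)) = PA (last rs) (last (deriv_coeffs rs))"
      using ne len by (simp add: last_map last_zip del: length_Cons)
    then show ?thesis using Cons True ne by (simp add: algebra_simps of_nat_diff)
  next
    case False
    then obtain s where "rs = [s]" using ne by (cases rs) (auto simp: Suc_le_eq)
    then show ?thesis by simp
  qed
qed auto

lemma last_eval_has_derivative:
  "((\<lambda>y. last_eval rs xs y) has_real_derivative last_eval (deriv_coeffs rs) xs a) (at a)"
proof (induction rs)
  case (Cons r rs)
  show ?case unfolding last_eval_deriv_coeffs_Cons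
    by (auto intro!: derivative_eq_intros Cons)
qed auto

text \<open>Algebraicity over the field generated by \<open>xs\<close>, with denominators cleared.
  Nontriviality is required of the values of the coefficients, not of the expressions, since
  \<open>xs\<close> may satisfy relations.\<close>

definition algebraic_over :: "real list \<Rightarrow> real \<Rightarrow> bool" where
  "algebraic_over xs a \<longleftrightarrow> (\<exists>rs. (\<exists>r\<in>set rs. pev r xs \<noteq> 0) \<and> last_eval rs xs a = 0)"

text \<open>A list of least length serves as minimal polynomial \<open>ms\<close>. Its derivative is
  shorter and has a nonzero leading coefficient, so by minimality it does not vanish at
  \<open>a\<close>: the root is simple.\<close>

lemma algebraic_minimal:
  assumes "algebraic_over xs a"
  obtains ms n where "length ms = Suc n" "n \<ge> 1" "pev (last ms) xs \<noteq> 0" "last_eval ms xs a = 0"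
    "last_eval (deriv_coeffs ms) xs a \<noteq> 0"
    "\<And>rs r. length rs \<le> n \<Longrightarrow> last_eval rs xs a = 0 \<Longrightarrow> r \<in> set rs \<Longrightarrow> pev r xs = 0"
proof -
  define P where "P rs \<longleftrightarrow> (\<exists>r\<in>set rs. pev r xs \<noteq> 0) \<and> last_eval rs xs a = 0" for rs
  have "\<exists>rs. P rs" using assms by (auto simp: algebraic_over_def P_def)
  then obtain ms where ms: "P ms" and min: "\<And>rs. P rs \<Longrightarrow> length ms \<le> length rs"
    using ex_has_least_nat[of P _ length] by blast
  have ne: "ms \<noteq> []" using ms by (auto simp: P_def)
  then obtain n where n: "length ms = Suc n" by (cases ms) auto
  have lastms: "pev (last ms) xs \<noteq> 0"
  proof
    assume 0: "pev (last ms) xs = 0"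
    have eq: "ms = butlast ms @ [last ms]" using ne by simp
    have "last_eval (butlast ms) xs a = 0"
      using ms 0 last_eval_snoc[of "butlast ms" "last ms" xs a] ne by (simp add: P_def)
    moreover have "\<exists>r\<in>set (butlast ms). pev r xs \<noteq> 0"
      using ms 0 eq unfolding P_def by (metis Un_iff empty_iff empty_set insert_iff list.simps(15) set_append)
    ultimately have "P (butlast ms)" by (simp add: P_def)
    from min[OF this] n show False by simp
  qed
  have small: "pev r xs = 0" if "length rs \<le> n" "last_eval rs xs a = 0" "r \<in> set rs" for rs r
    using min[of rs] that n by (force simp: P_def)
  have n1: "n \<ge> 1"
  proof (rule ccontr)
    assume "\<not> n \<ge> 1"
    then have "n = 0" by simp
    then obtain r where "ms = [r]" using n by (auto simp: length_Suc_conv)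
    then show False using ms by (auto simp: P_def)
  qed
  have "last_eval (deriv_coeffs ms) xs a \<noteq> 0"
  proof
    assume 0: "last_eval (deriv_coeffs ms) xs a = 0"
    have len: "length (deriv_coeffs ms) = n" by (simp add: length_deriv_coeffs n)
    then have "last (deriv_coeffs ms) \<in> set (deriv_coeffs ms)" using n1 by (intro last_in_set) auto
    then have "pev (last (deriv_coeffs ms)) xs = 0" using small 0 len by blast
    moreover have "pev (last (deriv_coeffs ms)) xs = of_nat (length ms - 1) * pev (last ms) xs"
      by (rule pev_last_deriv_coeffs) (use n n1 in simp)
    ultimately show False using lastms n n1 by simp
  qed
  with that n n1 lastms ms small show ?thesis by (auto simp: P_def)
qed

text \<open>There are countably many coefficient lists, and each one that is nonzero at
  \<open>xs\<close> has finitely many roots.\<close>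

lemma countable_algebraic_over: "countable {a. algebraic_over xs a}"
proof -
  have poly: "poly (Poly (map (\<lambda>r. pev r xs) rs)) a = last_eval rs xs a" for rs a
    by (induction rs) auto
  have nz: "Poly (map (\<lambda>r. pev r xs) rs) \<noteq> 0" if "r \<in> set rs" "pev r xs \<noteq> 0" for rs r
    using that by (induction rs) (auto simp: )
  have "{a. algebraic_over xs a} \<subseteq> (\<Union>rs. if Poly (map (\<lambda>r. pev r xs) rs) = 0 then {} else
      {a. poly (Poly (map (\<lambda>r. pev r xs) rs)) a = 0})" (is "_ \<subseteq> (\<Union>rs. ?A rs)")
    unfolding algebraic_over_def using poly nz by fastforce
  moreover have "countable (\<Union>rs. ?A rs)"
    by (intro countable_UN) (auto intro!: countable_finite poly_roots_finite)
  ultimately show ?thesis using countable_subset by blast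
qed

text \<open>The coordinates are chosen one after another: the unit interval is uncountable, and only
  countably many of its points are algebraic over what has been chosen before.\<close>

lemma exists_generic:
  "\<exists>xs. length xs = d \<and> (\<forall>k<d. 0 < xs ! k \<and> xs ! k < 1 \<and> \<not> algebraic_over (cs @ take k xs) (xs ! k))"
proof (induction d)
  case (Suc d)
  then obtain xs where xs: "length xs = d"
    "\<And>k. k < d \<Longrightarrow> 0 < xs ! k \<and> xs ! k < 1 \<and> \<not> algebraic_over (cs @ take k xs) (xs ! k)"
    by blast
  have "uncountable {0<..<1 :: real}" by (rule uncountable_open_interval[THEN iffD2]) simp
  then have "\<not> {0<..<1} \<subseteq> {a. algebraic_over (cs @ xs) a}"
    using countable_algebraic_over countable_subset by blast
  then obtain a where "0 < a" "a < 1" "\<not> algebraic_over (cs @ xs) a"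
    by (auto simp: subset_iff)
  then show ?case using xs
    by (intro exI[of _ "xs @ [a]"]) (auto simp: nth_append less_Suc_eq)
qed auto

section \<open>Tangent vectors at generic points\<close>

text \<open>The dual numbers: \<open>Dual a v\<close> stands for a + v e with e^2 = 0. A polynomial
  evaluated at such arguments returns its value together with its directional derivative.\<close>

datatype dual = Dual (re: real) (du: real)

lemma dual_eqI: "re x = re y \<Longrightarrow> du x = du y \<Longrightarrow> x = y"
  by (cases x; cases y) auto

instantiation dual :: comm_ring_1
begin

definition "0 = Dual 0 0"
definition "1 = Dual 1 0"
definition "x + y = Dual (re x + re y) (du x + du y)"
definition "- x = Dual (- re x) (- du x)"
definition "x - y = Dual (re x - re y) (du x - du y)"
definition "x * y = Dual (re x * re y) (re x * du y + du x * re y)"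

instance
  by standard (auto simp: zero_dual_def one_dual_def plus_dual_def uminus_dual_def
      minus_dual_def times_dual_def algebra_simps)

end

lemma dual_sel [simp]:
  "re 0 = 0" "re 1 = 1" "re (x + y) = re x + re y" "re (- x) = - re x"
  "re (x - y) = re x - re y" "re (x * y) = re x * re y"
  "du 0 = 0" "du 1 = 0" "du (x + y) = du x + du y" "du (- x) = - du x"
  "du (x - y) = du x - du y" "du (x * y) = re x * du y + du x * re y"
  by (simp_all add: zero_dual_def one_dual_def plus_dual_def uminus_dual_def
      minus_dual_def times_dual_def)

lemma of_nat_dual: "of_nat k = Dual (of_nat k) 0"
  by (induction k) (auto intro: dual_eqI)

lemma of_int_dual: "of_int k = Dual (of_int k) 0"
  by (cases k rule: int_cases2) (auto simp: of_nat_dual intro: dual_eqI)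

lemma re_power: "re (x ^ k) = re x ^ k"
  by (induction k) auto

lemma re_peval: "re (peval p \<rho>) = peval p (\<lambda>i. re (\<rho> i))"
  by (induction p) (auto simp: of_int_dual)

lemma re_pev: "re (pev p ds) = pev p (map re ds)"
  unfolding re_peval by (rule arg_cong[of _ _ "peval p"]) (auto simp: nth_default_def)

lemma re_last_eval: "re (last_eval rs ds y) = last_eval rs (map re ds) (re y)"
  by (induction rs) (auto simp: re_pev)

abbreviation real_dual :: "real \<Rightarrow> dual" where
  "real_dual x \<equiv> Dual x 0"

lemma pev_real_dual: "pev p (map real_dual xs) = real_dual (pev p xs)"
proof -
  have "peval p (\<lambda>i. real_dual (\<rho> i)) = real_dual (peval p \<rho>)" for \<rho>
    by (induction p) (auto simp: of_int_dual intro: dual_eqI)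
  moreover have "nth_default 0 (map real_dual xs) = (\<lambda>i. real_dual (nth_default 0 xs i))"
    by (auto simp: nth_default_def zero_dual_def)
  ultimately show ?thesis by simp
qed

lemma last_eval_real_dual: "last_eval rs (map real_dual xs) (real_dual y) = real_dual (last_eval rs xs y)"
  by (induction rs) (auto simp: pev_real_dual intro: dual_eqI)

lemma dual_mult_eq_0: "x * y = 0 \<Longrightarrow> re x \<noteq> 0 \<Longrightarrow> y = (0 :: dual)"
proof -
  assume a: "x * y = 0" "re x \<noteq> 0"
  have "re (x * y) = 0" "du (x * y) = 0" unfolding a by auto
  then show ?thesis using a(2) by (auto intro: dual_eqI)
qed

text \<open>Taylor expansion, which stops after the linear term because
  \<open>e * e = 0\<close>.\<close>

lemma last_eval_add_nilpotent:
  assumes "e * e = 0"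
  shows "last_eval rs xs (y + e) = last_eval rs xs y + e * last_eval (deriv_coeffs rs) xs y"
proof (induction rs)
  case (Cons r rs)
  have "last_eval (r # rs) xs (y + e) = pev r xs + (y + e) * (last_eval rs xs y + e * last_eval (deriv_coeffs rs) xs y)"
    by (simp add: Cons)
  also have "\<dots> = last_eval (r # rs) xs y + e * (last_eval rs xs y + y * last_eval (deriv_coeffs rs) xs y)
      + e * e * last_eval (deriv_coeffs rs) xs y" by (simp add: algebra_simps)
  finally show ?case unfolding assms last_eval_deriv_coeffs_Cons by simp
qed auto

text \<open>The infinitesimal parts of \<open>ds\<close> form a tangent vector, at the point of the real parts, to
  every variety over the integers through that point.\<close>

definition tangent :: "dual list \<Rightarrow> bool" where
  "tangent ds \<longleftrightarrow> (\<forall>p. re (pev p ds) = 0 \<longrightarrow> pev p ds = 0)"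

lemma tangent_real_dual: "tangent (map real_dual xs)"
  by (auto simp: tangent_def pev_real_dual intro: dual_eqI)

lemma pev_subring:
  assumes "\<And>d. d \<in> set es \<Longrightarrow> \<exists>p. d = pev p ds"
  shows "\<exists>q. pev p es = pev q ds"
proof -
  have "\<exists>q. nth_default 0 es i = pev q ds" for i
  proof (cases "i < length es")
    case True
    then show ?thesis using assms[of "es ! i"] by (auto simp: nth_default_def)
  next
    case False
    then have "nth_default 0 es i = pev (PC 0) ds" by (simp add: nth_default_def)
    then show ?thesis ..
  qed
  then obtain \<sigma> where "\<And>i. nth_default 0 es i = pev (\<sigma> i) ds" by metis
  then have "nth_default 0 es = (\<lambda>i. pev (\<sigma> i) ds)" by (rule ext)
  then have "pev p es = pev (psubst \<sigma> p) ds" by (simp only: peval_psubst)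
  then show ?thesis ..
qed

lemma pev_PV_nth: "i < length xs \<Longrightarrow> pev (PV i) xs = xs ! i"
  by (simp add: nth_default_def)

lemma pev_in_set: "d \<in> set ds \<Longrightarrow> \<exists>p. d = pev p ds"
  by (metis in_set_conv_nth pev_PV_nth)

text \<open>A polynomial map pushes tangent vectors forward: an equation on \<open>es\<close>
  becomes an equation on \<open>ds\<close> by substitution.\<close>

lemma tangent_mono:
  assumes "tangent ds" "\<And>d. d \<in> set es \<Longrightarrow> \<exists>p. d = pev p ds"
  shows "tangent es"
  unfolding tangent_def using pev_subring[OF assms(2)] assms(1) tangent_def by metis

lemma tangent_subset:
  assumes "tangent ds" "set es \<subseteq> set ds"
  shows "tangent es"
  by (rule tangent_mono[OF assms(1)]) (use assms(2) in \<open>blast intro: pev_in_set\<close>)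

text \<open>Since \<open>a\<close> satisfies no nontrivial equation over the real parts of
  \<open>ds\<close>, an equation valid at the longer point holds coefficient by coefficient on
  \<open>ds\<close>. It therefore puts no constraint on \<open>v\<close>.\<close>

lemma tangent_extend_free:
  assumes "tangent ds" "\<not> algebraic_over (map re ds) a"
  shows "tangent (ds @ [Dual a v])"
  unfolding tangent_def
proof (intro allI impI)
  fix p assume 0: "re (pev p (ds @ [Dual a v])) = 0"
  let ?rs = "last_coeffs (length ds) p"
  have eq: "pev p (ds @ [Dual a v]) = last_eval ?rs ds (Dual a v)" by (simp add: last_eval_last_coeffs)
  have "last_eval ?rs (map re ds) a = 0" using 0 unfolding eq re_last_eval by simp
  then have "\<forall>r\<in>set ?rs. pev r (map re ds) = 0" using assms(2) by (auto simp: algebraic_over_def)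
  then have "\<forall>r\<in>set ?rs. pev r ds = 0" using assms(1) by (auto simp: tangent_def re_pev)
  then show "pev p (ds @ [Dual a v]) = 0" unfolding eq by (rule last_eval_zero)
qed

text \<open>If \<open>a\<close> is transcendental, any \<open>v\<close> will do. If it is algebraic,
  implicit differentiation of its minimal polynomial determines \<open>v\<close>. Every other
  equation reduces modulo that polynomial to a remainder whose coefficients vanish on the real
  parts, hence on \<open>ds\<close>; the power of the leading coefficient is a unit in the dual
  numbers and can be cancelled.\<close>

lemma tangent_extend:
  assumes "tangent ds"
  shows "\<exists>v. tangent (ds @ [Dual a v])"
proof (cases "algebraic_over (map re ds) a")
  case True
  then obtain ms n where ms: "length ms = Suc n" "n \<ge> 1" "pev (last ms) (map re ds) \<noteq> 0"
    "last_eval ms (map re ds) a = 0" "last_eval (deriv_coeffs ms) (map re ds) a \<noteq> 0"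
    and min: "\<And>rs r. length rs \<le> n \<Longrightarrow> last_eval rs (map re ds) a = 0 \<Longrightarrow> r \<in> set rs \<Longrightarrow>
      pev r (map re ds) = 0"
    using algebraic_minimal by metis
  define u where "u = last_eval ms ds (real_dual a)"
  define w where "w = last_eval (deriv_coeffs ms) ds (real_dual a)"
  have u: "re u = 0" and w: "re w \<noteq> 0" using ms by (simp_all add: u_def w_def re_last_eval)
  \<comment> \<open>The infinitesimal part of \<open>last_eval ms ds (Dual a v)\<close> is
    \<open>du u + v * re w\<close>, and its real part is \<open>re u = 0\<close>; this
    \<open>v\<close> makes both parts vanish.\<close>
  define v where "v = - du u / re w"
  have y: "Dual a v = real_dual a + Dual 0 v" by (simp add: plus_dual_def)
  have root: "last_eval ms ds (Dual a v) = 0"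
    unfolding y by (subst last_eval_add_nilpotent)
      (use u w in \<open>auto simp: u_def[symmetric] w_def[symmetric] v_def intro: dual_eqI\<close>)
  have "tangent (ds @ [Dual a v])"
    unfolding tangent_def
  proof (intro allI impI)
    fix p assume 0: "re (pev p (ds @ [Dual a v])) = 0"
    let ?rs = "last_coeffs (length ds) p"
    have eq: "pev p (ds @ [Dual a v]) = last_eval ?rs ds (Dual a v)" by (simp add: last_eval_last_coeffs)
    obtain E ss where ss: "length ss = n"
      "pev (last ms) ds ^ E * last_eval ?rs ds (Dual a v) = last_eval ss ds (Dual a v)"
      using pseudo_remainder[OF ms(1,2), of ?rs] root by metis
    have "re (last_eval ss ds (Dual a v)) = 0" using 0 unfolding ss(2)[symmetric] eq by simp
    then have "last_eval ss (map re ds) a = 0" by (simp add: re_last_eval)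
    then have "\<forall>r\<in>set ss. pev r (map re ds) = 0" using min ss(1) by auto
    then have "\<forall>r\<in>set ss. pev r ds = 0" using assms by (auto simp: tangent_def re_pev)
    then have "last_eval ss ds (Dual a v) = 0" by (rule last_eval_zero)
    then show "pev p (ds @ [Dual a v]) = 0"
      using dual_mult_eq_0[of "pev (last ms) ds ^ E"] ss(2) ms(3) unfolding eq
      by (simp add: re_power re_pev)
  qed
  then show ?thesis ..
qed (use tangent_extend_free assms in blast)

lemma tangent_extend_list:
  assumes "tangent ds"
  shows "\<exists>vs. length vs = length xs \<and> tangent (ds @ map2 Dual xs vs)"
proof (induction xs rule: rev_induct)
  case (snoc x xs)
  then obtain vs where vs: "length vs = length xs" "tangent (ds @ map2 Dual xs vs)" by blast
  from tangent_extend[OF this(2), of x] obtain v where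
    "tangent ((ds @ map2 Dual xs vs) @ [Dual x v])" by blast
  then show ?case using vs(1) by (intro exI[of _ "vs @ [v]"]) simp
qed (use assms in simp)

lemma tangent_extend_generic:
  assumes "tangent ds" "length vs = length xs"
    "\<And>k. k < length xs \<Longrightarrow> \<not> algebraic_over (map re ds @ take k xs) (xs ! k)"
  shows "tangent (ds @ map2 Dual xs vs)"
proof -
  have "tangent (ds @ map2 Dual (take k xs) (take k vs))" if "k \<le> length xs" for k
    using that
  proof (induction k)
    case (Suc k)
    have "map re (map2 Dual xs vs) = xs" using assms(2) by (induction rule: list_induct2) auto
    then have re_eq: "map re (map2 Dual (take k xs) (take k vs)) = take k xs"
      by (simp flip: take_map take_zip)
    have "tangent ((ds @ map2 Dual (take k xs) (take k vs)) @ [Dual (xs ! k) (vs ! k)])"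
      by (rule tangent_extend_free)
        (use Suc assms(3)[of k] re_eq in auto)
    then show ?case using Suc.prems assms(2) by (simp add: take_Suc_conv_app_nth)
  qed (use assms(1) in simp)
  from this[of "length xs"] show ?thesis using assms(2) by simp
qed

lemma ex_pev_eq_last_eval:
  "\<exists>p. \<forall>xs (y :: 'a :: comm_ring_1). length xs = N \<longrightarrow> pev p (xs @ [y]) = last_eval rs xs y"
proof (induction rs)
  case Nil
  show ?case by (rule exI[of _ "PC 0"]) auto
next
  case (Cons r rs)
  then obtain p where p: "\<And>xs (y :: 'a). length xs = N \<Longrightarrow> pev p (xs @ [y]) = last_eval rs xs y" by blast
  \<comment> \<open>In \<open>pev r xs\<close> a variable from index \<open>N\<close> on has the
    value 0; without the cut-off, variable \<open>N\<close> would read \<open>y\<close> in the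
    longer list.\<close>
  let ?r = "psubst (\<lambda>i. if i < N then PV i else PC 0) r"
  have "pev ?r (xs @ [y]) = pev r xs" if "length xs = N" for xs and y :: 'a
    unfolding peval_psubst
    by (rule arg_cong[of _ _ "peval r"]) (use that in \<open>auto simp: nth_default_def nth_append\<close>)
  then show ?case using p
    by (intro exI[of _ "PA ?r (PM (PV N) p)"]) (simp add: nth_default_append[of _ _ _ N])
qed

text \<open>With \<open>xs\<close> standing still, the minimal equation of \<open>a\<close> says
  that \<open>v\<close> times the derivative at a simple root is 0.\<close>

lemma tangent_algebraic_zero:
  assumes "tangent (map real_dual xs @ [Dual a v])" "algebraic_over xs a"
  shows "v = 0"
proof -
  obtain ms where ms: "last_eval ms xs a = 0" "last_eval (deriv_coeffs ms) xs a \<noteq> 0"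
    using algebraic_minimal[OF assms(2)] by metis
  obtain p where p: "\<And>ds (y :: dual). length ds = length xs \<Longrightarrow> pev p (ds @ [y]) = last_eval ms ds y"
    using ex_pev_eq_last_eval by metis
  have p_eq: "pev p (map real_dual xs @ [Dual a v]) = last_eval ms (map real_dual xs) (Dual a v)"
    by (rule p) simp
  have y: "Dual a v = real_dual a + Dual 0 v" by (simp add: plus_dual_def)
  have eq: "last_eval ms (map real_dual xs) (Dual a v) = Dual 0 (v * last_eval (deriv_coeffs ms) xs a)"
    unfolding y by (subst last_eval_add_nilpotent)
      (auto simp: last_eval_real_dual ms intro: dual_eqI)
  have "pev p (map real_dual xs @ [Dual a v]) = 0"
    using assms(1) unfolding tangent_def p_eq eq by (metis dual.sel(1) eq p_eq)
  then have "Dual 0 (v * last_eval (deriv_coeffs ms) xs a) = 0" unfolding p_eq eq .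
  then have "v * last_eval (deriv_coeffs ms) xs a = 0" by (metis dual.sel(2) dual_sel(7))
  then show ?thesis using ms by simp
qed

text \<open>A stepwise form of the condition that all entries of \<open>xs\<close> are algebraic
  over \<open>bs\<close>, suited to induction along the list.\<close>

definition tower :: "real list \<Rightarrow> real list \<Rightarrow> bool" where
  "tower bs xs \<longleftrightarrow> (\<forall>k<length xs. algebraic_over (bs @ take k xs) (xs ! k))"

text \<open>Used in the contrapositive: a tangent vector that fixes \<open>bs\<close> but moves
  \<open>xs\<close> shows that some entry of \<open>xs\<close> is transcendental over its
  predecessors.\<close>

lemma tangent_tower_zero:
  assumes "tangent (map real_dual bs @ map2 Dual xs vs)" "length vs = length xs" "tower bs xs"
  shows "k < length xs \<Longrightarrow> vs ! k = 0"
proof (induction k rule: less_induct)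
  case (less k)
  have "map2 Dual (take k xs) (take k vs) = map real_dual (take k xs)"
    using less assms(2) by (auto intro!: nth_equalityI)
  then have split: "map2 Dual (take (Suc k) xs) (take (Suc k) vs) =
      map real_dual (take k xs) @ [Dual (xs ! k) (vs ! k)]"
    using less.prems assms(2) by (simp add: take_Suc_conv_app_nth)
  have "set (map2 Dual (take (Suc k) xs) (take (Suc k) vs)) \<subseteq> set (map2 Dual xs vs)"
    by (metis set_take_subset take_map take_zip)
  then have "tangent (map real_dual bs @ map2 Dual (take (Suc k) xs) (take (Suc k) vs))"
    by (intro tangent_subset[OF assms(1)]) auto
  then have "tangent (map real_dual (bs @ take k xs) @ [Dual (xs ! k) (vs ! k)])"
    unfolding split by simp
  then show ?case
    using assms(3) less.prems unfolding tower_def by (blast intro: tangent_algebraic_zero)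
qed

section \<open>Perturbation of points that are not algebraic\<close>

text \<open>Neighbourhoods for the maximum distance; \<open>list_all2\<close> also fixes the length.
  As a filter it turns the existence of nearby solutions into \<open>frequently\<close> and open
  conditions into \<open>eventually\<close>, and these two combine.\<close>

definition list_nhds :: "real list \<Rightarrow> real list filter" where
  "list_nhds xs = (INF \<delta>\<in>{0<..}. principal {ys. list_all2 (\<lambda>x y. \<bar>x - y\<bar> < \<delta>) xs ys})"

lemma eventually_list_nhds:
  "eventually P (list_nhds xs) \<longleftrightarrow> (\<exists>\<delta>>0. \<forall>ys. list_all2 (\<lambda>x y. \<bar>x - y\<bar> < \<delta>) xs ys \<longrightarrow> P ys)"
  unfolding list_nhds_def
proof (subst eventually_INF_base)
  fix a b :: real assume ab: "a \<in> {0<..}" "b \<in> {0<..}"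
  have "min a b \<in> {0<..}" using ab by simp
  moreover have "principal {ys. list_all2 (\<lambda>x y. \<bar>x - y\<bar> < min a b) xs ys} \<le>
      inf (principal {ys. list_all2 (\<lambda>x y. \<bar>x - y\<bar> < a) xs ys})
          (principal {ys. list_all2 (\<lambda>x y. \<bar>x - y\<bar> < b) xs ys})"
    by (auto elim: list_all2_mono)
  ultimately show "\<exists>x\<in>{0<..}. principal {ys. list_all2 (\<lambda>u y. \<bar>u - y\<bar> < x) xs ys} \<le>
      inf (principal {ys. list_all2 (\<lambda>x y. \<bar>x - y\<bar> < a) xs ys})
          (principal {ys. list_all2 (\<lambda>x y. \<bar>x - y\<bar> < b) xs ys})" by blast
qed (auto simp: eventually_principal)

lemma frequently_list_nhds:
  "frequently P (list_nhds xs) \<longleftrightarrow> (\<forall>\<delta>>0. \<exists>ys. list_all2 (\<lambda>x y. \<bar>x - y\<bar> < \<delta>) xs ys \<and> P ys)"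
  unfolding frequently_def eventually_list_nhds by auto

lemma tendsto_nth_list_nhds:
  "((\<lambda>ys. nth_default 0 (bs @ ys) i) \<longlongrightarrow> nth_default 0 (bs @ xs) i) (list_nhds xs)"
proof (rule tendstoI)
  fix e :: real assume "e > 0"
  then show "\<forall>\<^sub>F ys in list_nhds xs. dist (nth_default 0 (bs @ ys) i) (nth_default 0 (bs @ xs) i) < e"
    unfolding eventually_list_nhds
    by (intro exI[of _ e])
      (auto simp: nth_default_def nth_append list_all2_conv_all_nth dist_real_def abs_minus_commute)
qed

lemma tendsto_pev: "((\<lambda>ys. pev p (bs @ ys)) \<longlongrightarrow> pev p (bs @ xs)) (list_nhds xs)"
  by (induction p) (auto intro!: tendsto_intros tendsto_nth_list_nhds)

lemma tendsto_last_eval: "((\<lambda>ys. last_eval rs (bs @ ys) y) \<longlongrightarrow> last_eval rs (bs @ xs) y) (list_nhds xs)"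
  by (induction rs) (auto intro!: tendsto_intros tendsto_pev)

text \<open>The product form covers both signs of \<open>l\<close> and is an open condition, so it
  survives a small change of the coefficients.\<close>

lemma simple_root_sign_change:
  fixes f :: "real \<Rightarrow> real"
  assumes "(f has_real_derivative l) (at a)" "l \<noteq> 0" "f a = 0" "\<delta> > 0"
  shows "\<exists>b c. a - \<delta> < b \<and> b < a \<and> a < c \<and> c < a + \<delta> \<and> f b * f c < 0"
proof -
  have *: "\<exists>b c. a - \<delta> < b \<and> b < a \<and> a < c \<and> c < a + \<delta> \<and> g b * g c < 0"
    if g: "(g has_real_derivative l) (at a)" "l > 0" "g a = 0" for g :: "real \<Rightarrow> real" and l
  proof -
    obtain d where d: "d > 0" "\<And>h. 0 < h \<Longrightarrow> h < d \<Longrightarrow> g a < g (a + h)"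
      using DERIV_pos_inc_right[OF g(1,2)] by blast
    obtain e where e: "e > 0" "\<And>h. 0 < h \<Longrightarrow> h < e \<Longrightarrow> g (a - h) < g a"
      using DERIV_pos_inc_left[OF g(1,2)] by blast
    define h where "h = min \<delta> (min d e) / 2"
    have h: "0 < h" "h < \<delta>" "h < d" "h < e" using assms(4) d(1) e(1) by (auto simp: h_def)
    then have "g (a - h) < 0" "g (a + h) > 0" using d(2)[of h] e(2)[of h] g(3) by auto
    then have "g (a - h) * g (a + h) < 0" by (rule mult_neg_pos)
    then show ?thesis using h by (intro exI[of _ "a - h"] exI[of _ "a + h"]) auto
  qed
  show ?thesis
  proof (cases "l > 0")
    case False
    then show ?thesis using *[of "\<lambda>x. - f x" "- l"] assms by (auto intro!: derivative_eq_intros)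
  qed (use * assms in blast)
qed

text \<open>Induction on the length: the equations on \<open>xs @ [a]\<close> are replaced by
  finitely many equations on \<open>xs\<close> alone, which depend on whether \<open>a\<close> is
  transcendental or algebraic over \<open>bs @ xs\<close>.\<close>

lemma not_tower_movable:
  assumes "\<not> tower bs xs" "\<forall>p\<in>set ps. pev p (bs @ xs) = 0"
  shows "\<exists>\<^sub>F ys in list_nhds xs. ys \<noteq> xs \<and> (\<forall>p\<in>set ps. pev p (bs @ ys) = 0)"
  using assms
proof (induction xs arbitrary: ps rule: rev_induct)
  case Nil
  then show ?case by (simp add: tower_def)
next
  case (snoc a xs)
  define N where "N = length (bs @ xs)"
  have last_eval_N: "last_eval (last_coeffs N p) (bs @ ys) y = pev p (bs @ ys @ [y])"
    if "length ys = length xs" for ys p y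
    using last_eval_last_coeffs[of "bs @ ys" p y] that by (simp add: N_def)
  have tower_snoc: "tower bs (xs @ [a]) \<longleftrightarrow> tower bs xs \<and> algebraic_over (bs @ xs) a"
    by (auto simp: tower_def nth_append less_Suc_eq)
  have coeffs0: "\<forall>r\<in>set (last_coeffs N p). pev r (bs @ xs) = 0"
    if "\<not> algebraic_over (bs @ xs) a" "p \<in> set ps" for p
    using that snoc.prems(2) last_eval_N[of xs p a] unfolding algebraic_over_def by force
  show ?case
  proof (cases "tower bs xs")
    case True
    \<comment> \<open>Only the last step of the tower fails, so the equations hold identically in
      the last variable, and \<open>a\<close> itself can be moved.\<close>
    then have free: "\<not> algebraic_over (bs @ xs) a" using snoc.prems tower_snoc by blast
    have "list_all2 (\<lambda>x y. \<bar>x - y\<bar> < \<delta>) (xs @ [a]) (xs @ [a + \<delta> / 2])" if "\<delta> > 0" for \<delta>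
      using that by (auto intro!: list_all2_appendI simp: list_all2_refl)
    moreover have "xs @ [a + \<delta> / 2] \<noteq> xs @ [a]" if "\<delta> > 0" for \<delta> :: real using that by simp
    moreover have "pev p (bs @ xs @ [a + \<delta> / 2]) = 0" if "p \<in> set ps" for p \<delta>
      using last_eval_zero[OF coeffs0[OF free that]] last_eval_N[of xs p] by simp
    ultimately show ?thesis unfolding frequently_list_nhds by blast
  next
    case not_tower: False
    show ?thesis unfolding frequently_list_nhds
    proof (intro allI impI)
      fix \<delta> :: real assume \<delta>: "\<delta> > 0"
      have near: "\<forall>\<^sub>F ys in list_nhds xs. list_all2 (\<lambda>x y. \<bar>x - y\<bar> < \<delta>) xs ys"
        unfolding eventually_list_nhds using \<delta> by blast
      show "\<exists>ys. list_all2 (\<lambda>x y. \<bar>x - y\<bar> < \<delta>) (xs @ [a]) ys \<and>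
          ys \<noteq> xs @ [a] \<and> (\<forall>p\<in>set ps. pev p (bs @ ys) = 0)"
      proof (cases "algebraic_over (bs @ xs) a")
        case False
        \<comment> \<open>All coefficients vanish at \<open>xs\<close>. Moving \<open>xs\<close>
          along their common zeros keeps the equations valid with \<open>a\<close>
          unchanged.\<close>
        have "\<forall>q\<in>set (concat (map (last_coeffs N) ps)). pev q (bs @ xs) = 0"
          using coeffs0[OF False] by auto
        from frequently_ex[OF frequently_eventually_frequently[OF snoc.IH[OF not_tower this] near]]
        obtain ys where ys: "ys \<noteq> xs" "\<forall>q\<in>set (concat (map (last_coeffs N) ps)). pev q (bs @ ys) = 0"
          "list_all2 (\<lambda>x y. \<bar>x - y\<bar> < \<delta>) xs ys"
          by blast
        have "pev p (bs @ ys @ [a]) = 0" if "p \<in> set ps" for p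
          using last_eval_zero[of "last_coeffs N p" "bs @ ys" a] ys(2) that
            last_eval_N[of ys p a] list_all2_lengthD[OF ys(3)] by auto
        then show ?thesis using ys \<delta>
          by (intro exI[of _ "ys @ [a]"]) (auto intro: list_all2_appendI)
      next
        case True
        then obtain ms n where ms: "length ms = Suc n" "n \<ge> 1" "pev (last ms) (bs @ xs) \<noteq> 0"
          "last_eval ms (bs @ xs) a = 0" "last_eval (deriv_coeffs ms) (bs @ xs) a \<noteq> 0"
          and min: "\<And>rs r. length rs \<le> n \<Longrightarrow> last_eval rs (bs @ xs) a = 0 \<Longrightarrow> r \<in> set rs \<Longrightarrow>
            pev r (bs @ xs) = 0"
          using algebraic_minimal by metis
        have "\<forall>p. \<exists>E ss. length ss = n \<and> (\<forall>xs (y :: real). last_eval ms xs y = 0 \<longrightarrow>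
           pev (last ms) xs ^ E * last_eval (last_coeffs N p) xs y = last_eval ss xs y)"
          using pseudo_remainder[OF ms(1,2)] by blast
        then obtain E ss where ss: "\<And>p. length (ss p) = n"
          "\<And>p xs (y :: real). last_eval ms xs y = 0 \<Longrightarrow>
           pev (last ms) xs ^ E p * last_eval (last_coeffs N p) xs y = last_eval (ss p) xs y" by metis
        \<comment> \<open>The remainders modulo the minimal polynomial vanish at \<open>a\<close>
          and are too short to be nonzero, so their coefficients are the equations to preserve on
          \<open>xs\<close>.\<close>
        have "pev q (bs @ xs) = 0" if "p \<in> set ps" "q \<in> set (ss p)" for p q
        proof -
          have "last_eval (ss p) (bs @ xs) a = 0"
            using ss(2)[OF ms(4), of p] last_eval_N[of xs p a] snoc.prems(2) that by simp
          then show ?thesis using min[of "ss p" q] ss(1) that by simp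
        qed
        then have "\<forall>q\<in>set (concat (map ss ps)). pev q (bs @ xs) = 0" by auto
        note IH = snoc.IH[OF not_tower this]
        \<comment> \<open>The root \<open>a\<close> is simple, so the minimal polynomial changes
          sign near it. After a small motion of \<open>xs\<close> it still does, and the
          intermediate value theorem gives a root close to \<open>a\<close>.\<close>
        obtain b c where bc: "a - \<delta> < b" "b < a" "a < c" "c < a + \<delta>"
          "last_eval ms (bs @ xs) b * last_eval ms (bs @ xs) c < 0"
          using simple_root_sign_change[OF last_eval_has_derivative ms(5,4) \<delta>] by blast
        have ev1: "\<forall>\<^sub>F ys in list_nhds xs. last_eval ms (bs @ ys) b * last_eval ms (bs @ ys) c < 0"
          by (rule order_tendstoD(2)[OF tendsto_mult[OF tendsto_last_eval tendsto_last_eval] bc(5)])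
        have ev2: "\<forall>\<^sub>F ys in list_nhds xs. pev (last ms) (bs @ ys) \<noteq> 0"
          by (rule tendsto_imp_eventually_ne[OF tendsto_pev ms(3)])
        from frequently_ex[OF frequently_eventually_frequently[OF IH
            eventually_conj[OF near eventually_conj[OF ev1 ev2]]]]
        obtain ys where ys: "ys \<noteq> xs" "\<forall>q\<in>set (concat (map ss ps)). pev q (bs @ ys) = 0"
          "list_all2 (\<lambda>x y. \<bar>x - y\<bar> < \<delta>) xs ys"
          "last_eval ms (bs @ ys) b * last_eval ms (bs @ ys) c < 0" "pev (last ms) (bs @ ys) \<noteq> 0"
          by auto
        have cont: "continuous_on {b..c} (\<lambda>y. last_eval ms (bs @ ys) y)"
          by (intro continuous_at_imp_continuous_on ballI DERIV_isCont) (rule last_eval_has_derivative)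
        have "\<exists>x. b \<le> x \<and> x \<le> c \<and> last_eval ms (bs @ ys) x = 0"
        proof (cases "last_eval ms (bs @ ys) b \<le> 0")
          case True
          then have "last_eval ms (bs @ ys) c \<ge> 0" using ys(4)
            by (auto simp: mult_less_0_iff)
          then show ?thesis using IVT'[OF True _ _ cont] bc by auto
        next
          case False
          then have "last_eval ms (bs @ ys) c \<le> 0" "last_eval ms (bs @ ys) b \<ge> 0" using ys(4)
            by (auto simp: mult_less_0_iff)
          then show ?thesis using IVT2'[of "\<lambda>y. last_eval ms (bs @ ys) y" c 0 b] cont bc by auto
        qed
        then obtain x where x: "b \<le> x" "x \<le> c" "last_eval ms (bs @ ys) x = 0" by blast
        have "pev p (bs @ ys @ [x]) = 0" if "p \<in> set ps" for p
        proof -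
          have "last_eval (ss p) (bs @ ys) x = 0"
            by (intro last_eval_zero) (use ys(2) that in auto)
          then have "pev (last ms) (bs @ ys) ^ E p * last_eval (last_coeffs N p) (bs @ ys) x = 0"
            using ss(2)[OF x(3)] by simp
          then show ?thesis using ys(5) last_eval_N[of ys p x] list_all2_lengthD[OF ys(3)] by simp
        qed
        moreover have "\<bar>a - x\<bar> < \<delta>" using bc x by auto
        ultimately show ?thesis using ys
          by (intro exI[of _ "ys @ [x]"]) (auto intro: list_all2_appendI)
      qed
    qed
  qed
qed

section \<open>Injective semi-algebraic maps\<close>

lemma underdetermined_system:
  fixes a :: "nat \<Rightarrow> nat \<Rightarrow> real"
  assumes "D < d"
  shows "\<exists>v. (\<exists>k<d. v k \<noteq> 0) \<and> (\<forall>l<D. (\<Sum>k<d. v k * a k l) = 0)"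
proof -
  define A where "A = mat d d (\<lambda>(l, k). if l < D then a k l else 0)"
  have A: "A \<in> carrier_mat d d" by (simp add: A_def)
  \<comment> \<open>The system is padded with zero rows to a square one; each product in the
    determinant contains a factor from the zero row \<open>D\<close>.\<close>
  have "(\<Prod>i = 0..<d. A $$ (i, p i)) = 0" if "p permutes {0..<d}" for p
    using assms that permutes_in_image[OF that, of D]
    by (intro prod_zero) (auto simp: A_def intro!: bexI[of _ D])
  then have "det A = 0" unfolding det_def'[OF A] by (intro sum.neutral) auto
  then obtain v where v: "v \<in> carrier_vec d" "v \<noteq> 0\<^sub>v d" "A *\<^sub>v v = 0\<^sub>v d"
    using det_0_iff_vec_prod_zero_field[OF A] by blast
  have "(\<Sum>k<d. v $ k * a k l) = 0" if l: "l < D" for l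
  proof -
    have "(A *\<^sub>v v) $ l = (\<Sum>k<d. v $ k * a k l)"
      using assms l v(1) unfolding A_def
      by (auto simp: scalar_prod_def lessThan_atLeast0 intro!: sum.cong)
    then show ?thesis using v(3) assms l by simp
  qed
  moreover have "\<exists>k<d. v $ k \<noteq> 0" using v(1,2) by (metis carrier_vecD eq_vecI index_zero_vec)
  ultimately show ?thesis by blast
qed

text \<open>At the fixed base point \<open>z\<close> the infinitesimal part is a directional
  derivative, hence linear in the direction. This makes the tangent vectors at a point a vector
  space.\<close>

lemma du_peval_linear:
  assumes "finite I"
  shows "du (peval p (\<lambda>i. Dual (z i) (\<Sum>k\<in>I. c k * v k i))) =
    (\<Sum>k\<in>I. c k * du (peval p (\<lambda>i. Dual (z i) (v k i))))"
  by (induction p)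
    (auto simp: of_int_dual re_peval sum.distrib sum_distrib_left sum_distrib_right algebra_simps)

lemma nth_default_map2_Dual:
  "length vs = length xs \<Longrightarrow>
    nth_default 0 (map2 Dual xs vs) = (\<lambda>i. Dual (nth_default 0 xs i) (nth_default 0 vs i))"
  by (auto simp: nth_default_def zero_dual_def)

lemma map_re_map2_Dual: "length vs = length xs \<Longrightarrow> map re (map2 Dual xs vs) = xs"
  by (induction vs xs rule: list_induct2) auto

lemma tangent_linear:
  assumes "finite I" "\<And>k. k \<in> I \<Longrightarrow> length (vs k) = length xs"
    "\<And>k. k \<in> I \<Longrightarrow> tangent (map2 Dual xs (vs k))"
  shows "tangent (map2 Dual xs (map (\<lambda>l. \<Sum>k\<in>I. c k * vs k ! l) [0..<length xs]))"
  unfolding tangent_def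
proof (intro allI impI)
  fix p
  let ?ws = "map (\<lambda>l. \<Sum>k\<in>I. c k * vs k ! l) [0..<length xs]"
  have ws: "nth_default 0 ?ws = (\<lambda>i. \<Sum>k\<in>I. c k * nth_default 0 (vs k) i)"
    using assms(2) by (auto simp: nth_default_def intro!: sum.cong)
  assume 0: "re (pev p (map2 Dual xs ?ws)) = 0"
  have p0: "pev p xs = 0" using 0 unfolding re_pev by (simp add: map_re_map2_Dual del: map_map)
  have "pev p (map2 Dual xs (vs k)) = 0" if "k \<in> I" for k
    using assms(2,3)[OF that] p0 by (simp add: tangent_def re_pev map_re_map2_Dual del: map_map)
  then have "du (pev p (map2 Dual xs ?ws)) = 0"
    by (simp add: nth_default_map2_Dual ws du_peval_linear assms(1,2) del: map_map)
  with 0 show "pev p (map2 Dual xs ?ws) = 0" by (auto intro: dual_eqI)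
qed

text \<open>The real constants of \<open>p\<close> become values of extra variables, which leaves
  integer coefficients. Allowing every larger list \<open>cs'\<close> lets several polynomials share
  one list of constants.\<close>

lemma poly_fun_pexp:
  assumes "p \<in> poly_fun m"
  shows "\<exists>cs. \<forall>cs'. set cs \<subseteq> set cs' \<longrightarrow>
    (\<exists>e. \<forall>z\<in>carrier_vec m. p z = pev e (cs' @ list_of_vec z))"
  using assms
proof induction
  case (const c)
  have "\<exists>e. \<forall>z\<in>carrier_vec m. c = pev e (cs' @ list_of_vec z)" if c: "set [c] \<subseteq> set cs'" for cs'
  proof -
    obtain i where "i < length cs'" "cs' ! i = c" using c by (auto simp: in_set_conv_nth)
    then show ?thesis by (intro exI[of _ "PV i"]) (auto simp: nth_default_def nth_append)
  qed
  then show ?case by blast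
next
  case (coord i)
  have "\<exists>e. \<forall>z\<in>carrier_vec m. z $ i = pev e (cs' @ list_of_vec z)" for cs'
    by (rule exI[of _ "PV (length cs' + i)"])
      (use coord in \<open>auto simp: nth_default_def nth_append\<close>)
  then show ?case by blast
next
  case (add p q)
  then obtain cs ds where
    p: "\<And>cs'. set cs \<subseteq> set cs' \<Longrightarrow> \<exists>e. \<forall>z\<in>carrier_vec m. p z = pev e (cs' @ list_of_vec z)"
    and q: "\<And>cs'. set ds \<subseteq> set cs' \<Longrightarrow> \<exists>e. \<forall>z\<in>carrier_vec m. q z = pev e (cs' @ list_of_vec z)"
    by blast
  have "\<exists>e. \<forall>z\<in>carrier_vec m. p z + q z = pev e (cs' @ list_of_vec z)"
    if sub: "set (cs @ ds) \<subseteq> set cs'" for cs'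
  proof -
    obtain e f where "\<forall>z\<in>carrier_vec m. p z = pev e (cs' @ list_of_vec z)"
      "\<forall>z\<in>carrier_vec m. q z = pev f (cs' @ list_of_vec z)" using p[of cs'] q[of cs'] sub by auto
    then show ?thesis by (intro exI[of _ "PA e f"]) simp
  qed
  then show ?case by blast
next
  case (mult p q)
  then obtain cs ds where
    p: "\<And>cs'. set cs \<subseteq> set cs' \<Longrightarrow> \<exists>e. \<forall>z\<in>carrier_vec m. p z = pev e (cs' @ list_of_vec z)"
    and q: "\<And>cs'. set ds \<subseteq> set cs' \<Longrightarrow> \<exists>e. \<forall>z\<in>carrier_vec m. q z = pev e (cs' @ list_of_vec z)"
    by blast
  have "\<exists>e. \<forall>z\<in>carrier_vec m. p z * q z = pev e (cs' @ list_of_vec z)"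
    if sub: "set (cs @ ds) \<subseteq> set cs'" for cs'
  proof -
    obtain e f where "\<forall>z\<in>carrier_vec m. p z = pev e (cs' @ list_of_vec z)"
      "\<forall>z\<in>carrier_vec m. q z = pev f (cs' @ list_of_vec z)" using p[of cs'] q[of cs'] sub by auto
    then show ?thesis by (intro exI[of _ "PM e f"]) simp
  qed
  then show ?case by blast
qed

section \<open>Semi-algebraic sets near a point\<close>

lemma eventually_length_list_nhds: "\<forall>\<^sub>F ys in list_nhds xs. length ys = length xs"
  unfolding eventually_list_nhds by (auto intro!: exI[of _ 1] dest: list_all2_lengthD)

text \<open>Near \<open>z\<close>, membership in \<open>S\<close> is decided by finitely many equations which hold at \<open>z\<close>,
  because strict inequalities are open conditions.\<close>

definition locally_decided :: "real list \<Rightarrow> nat \<Rightarrow> real vec set \<Rightarrow> bool" where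
  "locally_decided cs m S \<longleftrightarrow> (\<forall>z\<in>carrier_vec m. \<exists>es.
     (\<forall>e\<in>set es. pev e (cs @ list_of_vec z) = 0) \<and>
     (\<forall>\<^sub>F ys in list_nhds (list_of_vec z).
        (\<forall>e\<in>set es. pev e (cs @ ys) = 0) \<longrightarrow> (vec_of_list ys \<in> S \<longleftrightarrow> z \<in> S)))"

lemma locally_decided_combine:
  assumes "locally_decided cs m S" "locally_decided cs m T"
    "\<And>y z. (y \<in> S \<longleftrightarrow> z \<in> S) \<Longrightarrow> (y \<in> T \<longleftrightarrow> z \<in> T) \<Longrightarrow> (y \<in> U \<longleftrightarrow> z \<in> U)"
  shows "locally_decided cs m U"
  unfolding locally_decided_def
proof
  fix z :: "real vec" assume z: "z \<in> carrier_vec m"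
  obtain es where es: "\<forall>e\<in>set es. pev e (cs @ list_of_vec z) = 0"
    "\<forall>\<^sub>F ys in list_nhds (list_of_vec z).
        (\<forall>e\<in>set es. pev e (cs @ ys) = 0) \<longrightarrow> (vec_of_list ys \<in> S \<longleftrightarrow> z \<in> S)"
    using assms(1) z unfolding locally_decided_def by blast
  obtain fs where fs: "\<forall>e\<in>set fs. pev e (cs @ list_of_vec z) = 0"
    "\<forall>\<^sub>F ys in list_nhds (list_of_vec z).
        (\<forall>e\<in>set fs. pev e (cs @ ys) = 0) \<longrightarrow> (vec_of_list ys \<in> T \<longleftrightarrow> z \<in> T)"
    using assms(2) z unfolding locally_decided_def by blast
  have "\<forall>\<^sub>F ys in list_nhds (list_of_vec z).
        (\<forall>e\<in>set (es @ fs). pev e (cs @ ys) = 0) \<longrightarrow> (vec_of_list ys \<in> U \<longleftrightarrow> z \<in> U)"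
    using eventually_conj[OF es(2) fs(2)]
  proof (rule eventually_mono)
    fix ys
    assume "((\<forall>e\<in>set es. pev e (cs @ ys) = 0) \<longrightarrow> (vec_of_list ys \<in> S \<longleftrightarrow> z \<in> S)) \<and>
      ((\<forall>e\<in>set fs. pev e (cs @ ys) = 0) \<longrightarrow> (vec_of_list ys \<in> T \<longleftrightarrow> z \<in> T))"
    then show "(\<forall>e\<in>set (es @ fs). pev e (cs @ ys) = 0) \<longrightarrow>
        (vec_of_list ys \<in> U \<longleftrightarrow> z \<in> U)"
      using assms(3)[of "vec_of_list ys" z] by simp
  qed
  moreover have "\<forall>e\<in>set (es @ fs). pev e (cs @ list_of_vec z) = 0" using es(1) fs(1) by auto
  ultimately show "\<exists>es. (\<forall>e\<in>set es. pev e (cs @ list_of_vec z) = 0) \<and>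
     (\<forall>\<^sub>F ys in list_nhds (list_of_vec z).
        (\<forall>e\<in>set es. pev e (cs @ ys) = 0) \<longrightarrow> (vec_of_list ys \<in> U \<longleftrightarrow> z \<in> U))" by blast
qed

lemma vec_of_list_carrier: "vec_of_list xs \<in> carrier_vec m \<longleftrightarrow> length xs = m"
  unfolding carrier_dim_vec dim_vec_of_list by (rule refl)

text \<open>Nearby lists have the length of \<open>z\<close>, so membership in the ambient space is
  decided as well.\<close>

lemma locally_decided_compl:
  assumes "locally_decided cs m S"
  shows "locally_decided cs m (carrier_vec m - S)"
  unfolding locally_decided_def
proof
  fix z :: "real vec" assume z: "z \<in> carrier_vec m"
  obtain es where *: "\<forall>e\<in>set es. pev e (cs @ list_of_vec z) = 0"
    "\<forall>\<^sub>F ys in list_nhds (list_of_vec z).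
        (\<forall>e\<in>set es. pev e (cs @ ys) = 0) \<longrightarrow> (vec_of_list ys \<in> S \<longleftrightarrow> z \<in> S)"
    using assms z unfolding locally_decided_def by blast
  have "\<forall>\<^sub>F ys in list_nhds (list_of_vec z).
        (\<forall>e\<in>set es. pev e (cs @ ys) = 0) \<longrightarrow>
          (vec_of_list ys \<in> carrier_vec m - S \<longleftrightarrow> z \<in> carrier_vec m - S)"
    using eventually_conj[OF *(2) eventually_length_list_nhds]
  proof (rule eventually_mono)
    fix ys
    assume "((\<forall>e\<in>set es. pev e (cs @ ys) = 0) \<longrightarrow> (vec_of_list ys \<in> S \<longleftrightarrow> z \<in> S)) \<and>
      length ys = length (list_of_vec z)"
    then show "(\<forall>e\<in>set es. pev e (cs @ ys) = 0) \<longrightarrow>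
          (vec_of_list ys \<in> carrier_vec m - S \<longleftrightarrow> z \<in> carrier_vec m - S)"
      using z vec_of_list_carrier[of ys m] by simp
  qed
  then show "\<exists>es. (\<forall>e\<in>set es. pev e (cs @ list_of_vec z) = 0) \<and>
     (\<forall>\<^sub>F ys in list_nhds (list_of_vec z).
        (\<forall>e\<in>set es. pev e (cs @ ys) = 0) \<longrightarrow>
          (vec_of_list ys \<in> carrier_vec m - S \<longleftrightarrow> z \<in> carrier_vec m - S))" using *(1) by blast
qed

lemma semialgebraic_locally_decided:
  assumes "semialgebraic m S"
  shows "\<exists>cs. \<forall>cs'. set cs \<subseteq> set cs' \<longrightarrow> locally_decided cs' m S"
  using assms
proof induction
  case (pos p)
  obtain cs where cs: "\<And>cs'. set cs \<subseteq> set cs' \<Longrightarrow>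
    \<exists>e. \<forall>z\<in>carrier_vec m. p z = pev e (cs' @ list_of_vec z)" using poly_fun_pexp[OF pos] by blast
  have "locally_decided cs' m {x \<in> carrier_vec m. 0 < p x}" if sub: "set cs \<subseteq> set cs'" for cs'
    unfolding locally_decided_def
  proof
    fix z :: "real vec" assume z: "z \<in> carrier_vec m"
    obtain e where e: "\<And>z. z \<in> carrier_vec m \<Longrightarrow> p z = pev e (cs' @ list_of_vec z)"
      using cs[OF sub] by blast
    have mem: "vec_of_list ys \<in> carrier_vec m" "p (vec_of_list ys) = pev e (cs' @ ys)"
      if "length ys = length (list_of_vec z)" for ys
      using that z e[of "vec_of_list ys"] by (simp_all add: vec_of_list_carrier list_vec)
    show "\<exists>es. (\<forall>e\<in>set es. pev e (cs' @ list_of_vec z) = 0) \<and>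
     (\<forall>\<^sub>F ys in list_nhds (list_of_vec z). (\<forall>e\<in>set es. pev e (cs' @ ys) = 0) \<longrightarrow>
        (vec_of_list ys \<in> {x \<in> carrier_vec m. 0 < p x} \<longleftrightarrow> z \<in> {x \<in> carrier_vec m. 0 < p x}))"
    \<comment> \<open>If \<open>p z = 0\<close>, this equation keeps nearby solutions outside the
      set. Otherwise the sign of \<open>p\<close> is constant near \<open>z\<close>, and the empty
      list of equations suffices.\<close>
    proof (cases "p z = 0")
      case True
      have "\<forall>\<^sub>F ys in list_nhds (list_of_vec z). (\<forall>e\<in>set [e]. pev e (cs' @ ys) = 0) \<longrightarrow>
        (vec_of_list ys \<in> {x \<in> carrier_vec m. 0 < p x} \<longleftrightarrow> z \<in> {x \<in> carrier_vec m. 0 < p x})"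
        using eventually_length_list_nhds[of "list_of_vec z"]
        by (rule eventually_mono) (use True mem in auto)
      moreover have "\<forall>e\<in>set [e]. pev e (cs' @ list_of_vec z) = 0" using e[OF z] True by simp
      ultimately show ?thesis by blast
    next
      case False
      have "\<forall>\<^sub>F ys in list_nhds (list_of_vec z). (pev e (cs' @ ys) > 0 \<longleftrightarrow> p z > 0)"
      proof (cases "p z > 0")
        case True
        have "\<forall>\<^sub>F ys in list_nhds (list_of_vec z). pev e (cs' @ ys) > 0"
          by (rule order_tendstoD(1)[OF tendsto_pev]) (use True e z in simp)
        then show ?thesis using True by simp
      next
        case not_pos: False
        have "\<forall>\<^sub>F ys in list_nhds (list_of_vec z). pev e (cs' @ ys) < 0"
          by (rule order_tendstoD(2)[OF tendsto_pev]) (use not_pos False e z in force)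
        then show ?thesis by (rule eventually_mono) (use not_pos in auto)
      qed
      from eventually_conj[OF this eventually_length_list_nhds]
      have "\<forall>\<^sub>F ys in list_nhds (list_of_vec z). (\<forall>e\<in>set []. pev e (cs' @ ys) = 0) \<longrightarrow>
        (vec_of_list ys \<in> {x \<in> carrier_vec m. 0 < p x} \<longleftrightarrow> z \<in> {x \<in> carrier_vec m. 0 < p x})"
        by (rule eventually_mono) (use z mem in auto)
      moreover have "\<forall>e\<in>set []. pev e (cs' @ list_of_vec z) = 0" by simp
      ultimately show ?thesis by blast
    qed
  qed
  then show ?case by blast
next
  case (union S T)
  then obtain cs ds where "\<And>cs'. set cs \<subseteq> set cs' \<Longrightarrow> locally_decided cs' m S"
    "\<And>cs'. set ds \<subseteq> set cs' \<Longrightarrow> locally_decided cs' m T" by blast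
  then have "\<And>cs'. set (cs @ ds) \<subseteq> set cs' \<Longrightarrow> locally_decided cs' m (S \<union> T)"
    by (rule_tac locally_decided_combine[of _ m S T]) (simp, simp, blast)
  then show ?case by blast
next
  case (inter S T)
  then obtain cs ds where "\<And>cs'. set cs \<subseteq> set cs' \<Longrightarrow> locally_decided cs' m S"
    "\<And>cs'. set ds \<subseteq> set cs' \<Longrightarrow> locally_decided cs' m T" by blast
  then have "\<And>cs'. set (cs @ ds) \<subseteq> set cs' \<Longrightarrow> locally_decided cs' m (S \<inter> T)"
    by (rule_tac locally_decided_combine[of _ m S T]) (simp, simp, blast)
  then show ?case by blast
qed (use locally_decided_compl in blast)

text \<open>The graph lists the point before its image, whereas \<open>not_tower_movable\<close>
  moves the end of a list; \<open>h\<close> renames the variables accordingly.\<close>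

lemma pev_rotate:
  "\<exists>q. \<forall>xs. length xs = d \<longrightarrow> pev p (cs @ xs @ ys) = pev q ((cs @ ys) @ xs)"
proof -
  define n m where "n = length cs" and "m = length ys"
  define h where "h i = (if i < n then PV i else if i < n + d then PV (m + i)
    else if i < n + d + m then PV (i - d) else PC 0)" for i
  have "pev p (cs @ xs @ ys) = pev (psubst h p) ((cs @ ys) @ xs)" if "length xs = d" for xs
    unfolding peval_psubst
    by (rule arg_cong[of _ _ "peval p"])
      (use that in \<open>auto simp: h_def n_def m_def nth_default_def nth_append fun_eq_iff algebra_simps\<close>)
  then show ?thesis by blast
qed

text \<open>The polynomials in \<open>param\<close> may vary with \<open>y\<close>, because only the
  image of a single generic point is examined.\<close>

theorem semialgebraic_injection_dim_le:
  assumes f: "semialgebraic_map d m (open_cube d) S f" and inj: "inj_on f (open_cube d)"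
    and param: "\<And>y. y \<in> S \<Longrightarrow> \<exists>ts. length ts = D \<and> (\<forall>i<m. \<exists>p. y $ i = pev p ts)"
  shows "d \<le> D"
proof (rule ccontr)
  assume "\<not> d \<le> D"
  then have "D < d" by simp
  define G where "G = (\<lambda>x. x @\<^sub>v f x) ` open_cube d"
  have G: "semialgebraic (d + m) G" and fS: "f ` open_cube d \<subseteq> S" and S: "S \<subseteq> carrier_vec m"
    using f by (auto simp: semialgebraic_map_def G_def)
  obtain cs where cs: "locally_decided cs (d + m) G"
    using semialgebraic_locally_decided[OF G] by blast
  obtain xs where xs: "length xs = d"
    "\<And>k. k < d \<Longrightarrow> 0 < xs ! k \<and> xs ! k < 1 \<and> \<not> algebraic_over (cs @ take k xs) (xs ! k)"
    using exists_generic[of d cs] by blast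
  define x where "x = vec_of_list xs"
  have x: "x \<in> open_cube d" using xs
    by (auto simp: open_cube_def x_def vec_of_list_carrier vec_of_list_index simp del: carrier_vecD)
  define ys where "ys = list_of_vec (f x)"
  have fx: "f x \<in> S" "f x \<in> carrier_vec m" using x fS S by auto
  then have ys: "length ys = m" by (simp add: ys_def)
  obtain ts where ts: "length ts = D" "\<And>i. i < m \<Longrightarrow> \<exists>p. f x $ i = pev p ts"
    using param[OF fx(1)] by blast
  \<comment> \<open>Each basis direction at the generic point \<open>xs\<close> is tangent with
    \<open>cs\<close> fixed, and it extends to a tangent vector with components \<open>us k\<close>
    along \<open>ts\<close>.\<close>
  define e where "e k = map (\<lambda>i. if i = k then 1 else 0 :: real) [0..<d]" for k
  have "\<exists>us. length us = D \<and> tangent ((map real_dual cs @ map2 Dual xs (e k)) @ map2 Dual ts us)" for k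
    unfolding ts(1)[symmetric]
    by (rule tangent_extend_list[OF tangent_extend_generic[OF tangent_real_dual]])
      (use xs in \<open>auto simp: e_def comp_def\<close>)
  then obtain us where us: "\<And>k. length (us k) = D"
    "\<And>k. tangent ((map real_dual cs @ map2 Dual xs (e k)) @ map2 Dual ts (us k))" by metis
  \<comment> \<open>The \<open>d\<close> vectors \<open>us k\<close> have only \<open>D < d\<close>
    components, so they are linearly dependent. The same combination of the full tangent vectors
    moves \<open>xs\<close> but neither \<open>cs\<close> nor \<open>ts\<close>.\<close>
  obtain v where v: "\<exists>k<d. v k \<noteq> 0" "\<And>l. l < D \<Longrightarrow> (\<Sum>k<d. v k * us k ! l) = 0"
    using underdetermined_system[OF \<open>D < d\<close>, of "\<lambda>k l. us k ! l"] by blast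
  define w where "w k = replicate (length cs) 0 @ e k @ us k" for k
  let ?zs = "cs @ xs @ ts"
  define ws where "ws = map (\<lambda>l. \<Sum>k<d. v k * w k ! l) [0..<length ?zs]"
  have len: "length (w k) = length ?zs" for k using us(1) xs(1) ts(1) by (simp add: w_def e_def)
  have zeros: "map2 Dual zs (replicate (length zs) 0) = map real_dual zs" for zs
    by (induction zs) auto
  have "map2 Dual ?zs (w k) = (map real_dual cs @ map2 Dual xs (e k)) @ map2 Dual ts (us k)" for k
    using xs(1) by (simp add: w_def zeros e_def)
  then have "tangent (map2 Dual ?zs ws)"
    unfolding ws_def using us(2) len by (intro tangent_linear) auto
  moreover have "ws = replicate (length cs) 0 @ map v [0..<d] @ replicate D 0"
  proof (rule nth_equalityI)
    show "length ws = length (replicate (length cs) 0 @ map v [0..<d] @ replicate D 0)"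
      using xs(1) ts(1) by (simp add: ws_def)
  next
    fix l assume "l < length ws"
    then have l: "l < length cs + d + D" using xs(1) ts(1) by (simp add: ws_def)
    then have ws_l: "ws ! l = (\<Sum>k<d. v k * w k ! l)" using xs(1) ts(1) by (simp add: ws_def)
    consider "l < length cs" | i where "i < d" "l = length cs + i" | i where "i < D" "l = length cs + (d + i)"
      using l by (metis add.assoc less_imp_add_positive linorder_not_less nat_add_left_cancel_less le_Suc_ex)
    then show "ws ! l = (replicate (length cs) 0 @ map v [0..<d] @ replicate D 0) ! l"
    proof cases
      case 1
      then show ?thesis unfolding ws_l by (simp add: w_def nth_append)
    next
      case 2
      then have "ws ! l = (\<Sum>k<d. if k = i then v k else 0)" unfolding ws_l
        by (intro sum.cong) (auto simp: w_def nth_append e_def)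
      then show ?thesis using 2 by (simp add: nth_append)
    next
      case 3
      then have "ws ! l = (\<Sum>k<d. v k * us k ! i)" unfolding ws_l
        by (intro sum.cong) (auto simp: w_def nth_append e_def)
      then show ?thesis using 3 v(2) by (simp add: nth_append)
    qed
  qed
  ultimately have tan: "tangent (map real_dual cs @ map2 Dual xs (map v [0..<d]) @ map real_dual ts)"
    using xs(1) zeros[of cs] zeros[of ts] unfolding ts(1) by simp
  \<comment> \<open>The entries of \<open>ys\<close> are integer polynomials in \<open>ts\<close>,
    which stands still, so \<open>ys\<close> stands still too.\<close>
  have "tangent (map real_dual (cs @ ys) @ map2 Dual xs (map v [0..<d]))"
  proof (rule tangent_mono[OF tan])
    fix b assume b: "b \<in> set (map real_dual (cs @ ys) @ map2 Dual xs (map v [0..<d]))"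
    let ?ds = "map real_dual cs @ map2 Dual xs (map v [0..<d]) @ map real_dual ts"
    show "\<exists>p. b = pev p ?ds"
    proof (cases "b \<in> real_dual ` set ys")
      case True
      then obtain i where "i < m" "b = real_dual (f x $ i)"
        using ys by (auto simp: in_set_conv_nth ys_def)
      then obtain p where "b = pev p (map real_dual ts)"
        using ts(2) pev_real_dual by metis
      moreover have "\<exists>q. pev p (map real_dual ts) = pev q ?ds"
        by (rule pev_subring) (auto intro!: pev_in_set)
      ultimately show ?thesis by simp
    next
      case False
      then show ?thesis using b by (intro pev_in_set) auto
    qed
  qed
  then have not_tower: "\<not> tower (cs @ ys) xs"
    using tangent_tower_zero[of "cs @ ys" xs "map v [0..<d]"] v(1) xs(1) by force
  have x_list: "list_of_vec x = xs" by (simp add: x_def list_vec)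
  have z: "x @\<^sub>v f x \<in> carrier_vec (d + m)" using x fx by (auto simp: open_cube_def)
  have zG: "x @\<^sub>v f x \<in> G" using x by (simp add: G_def)
  obtain es where es: "\<And>e. e \<in> set es \<Longrightarrow> pev e (cs @ xs @ ys) = 0"
    and ev: "\<forall>\<^sub>F zs in list_nhds (xs @ ys). (\<forall>e\<in>set es. pev e (cs @ zs) = 0) \<longrightarrow> vec_of_list zs \<in> G"
    using cs[unfolded locally_decided_def, rule_format, OF z] zG
    by (auto simp: x_list ys_def)
  obtain rot where rot: "\<And>p xs. length xs = d \<Longrightarrow> pev p (cs @ xs @ ys) = pev (rot p) ((cs @ ys) @ xs)"
    using pev_rotate[of d _ cs ys] by metis
  have "\<forall>p\<in>set (map rot es). pev p ((cs @ ys) @ xs) = 0" using es rot[OF xs(1)] by auto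
  note movable = not_tower_movable[OF not_tower this]
  \<comment> \<open>The image \<open>ys\<close> is held fixed and only the point moves. A nearby
    solution \<open>us\<close> then lies in the graph over the same image.\<close>
  have ev2: "\<forall>\<^sub>F us in list_nhds xs. (\<forall>e\<in>set es. pev e (cs @ us @ ys) = 0) \<longrightarrow> vec_of_list (us @ ys) \<in> G"
  proof -
    obtain \<delta> where "\<delta> > 0" and \<delta>: "\<And>zs. list_all2 (\<lambda>x y. \<bar>x - y\<bar> < \<delta>) (xs @ ys) zs \<Longrightarrow>
      (\<forall>e\<in>set es. pev e (cs @ zs) = 0) \<longrightarrow> vec_of_list zs \<in> G"
      using ev unfolding eventually_list_nhds by blast
    have "list_all2 (\<lambda>x y. \<bar>x - y\<bar> < \<delta>) (xs @ ys) (us @ ys)" if "list_all2 (\<lambda>x y. \<bar>x - y\<bar> < \<delta>) xs us" for us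
      using that \<open>\<delta> > 0\<close> by (auto intro!: list_all2_appendI list_all2_refl)
    then show ?thesis using \<delta> \<open>\<delta> > 0\<close> unfolding eventually_list_nhds by blast
  qed
  from frequently_ex[OF frequently_eventually_frequently[OF movable
    eventually_conj[OF ev2 eventually_length_list_nhds]]]
  obtain us where us: "us \<noteq> xs" "\<forall>p\<in>set (map rot es). pev p ((cs @ ys) @ us) = 0"
    "(\<forall>e\<in>set es. pev e (cs @ us @ ys) = 0) \<longrightarrow> vec_of_list (us @ ys) \<in> G" "length us = length xs"
    by blast
  then have "vec_of_list (us @ ys) \<in> G" using rot[of us] xs(1) by auto
  then obtain x' where x': "x' \<in> open_cube d" "vec_of_list (us @ ys) = x' @\<^sub>v f x'"
    by (auto simp: G_def)
  from arg_cong[OF x'(2), of list_of_vec] have "us @ ys = list_of_vec x' @ list_of_vec (f x')"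
    by (simp add: list_vec)
  moreover have "length us = length (list_of_vec x')" using us(4) xs(1) x'(1)
    by (auto simp: open_cube_def)
  ultimately have "us = list_of_vec x'" "ys = list_of_vec (f x')" by auto
  then have "f x' = f x" "x' \<noteq> x" using us(1) x_list unfolding ys_def by (metis vec_list)+
  then show False using inj x x'(1) by (auto dest: inj_onD)
qed

section \<open>Parameters for simultaneously triangularizable pairs\<close>

lemma forward_substitution:
  fixes l :: "nat \<Rightarrow> nat \<Rightarrow> 'a :: ring_1"
  assumes "\<And>i. i < n \<Longrightarrow> l i i = 1" "\<And>i k. i < k \<Longrightarrow> k < n \<Longrightarrow> l i k = 0"
  shows "\<exists>c. \<forall>i<n. (\<Sum>k<n. l i k * c k) = v i"
  using assms
proof (induction n)
  case (Suc n)
  then obtain c where c: "\<And>i. i < n \<Longrightarrow> (\<Sum>k<n. l i k * c k) = v i" by auto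
  define c' where "c' = c(n := v n - (\<Sum>k<n. l n k * c k))"
  have "(\<Sum>k<Suc n. l i k * c' k) = v i" if "i < Suc n" for i
  proof -
    have "(\<Sum>k<n. l i k * c' k) = (\<Sum>k<n. l i k * c k)"
      by (rule sum.cong) (auto simp: c'_def)
    then show ?thesis using c[of i] Suc.prems that by (cases "i = n") (auto simp: c'_def)
  qed
  then show ?case by blast
qed auto

text \<open>Column vectors of length \<open>n\<close> are functions; only their values below \<open>n\<close> matter.\<close>

definition rspan :: "nat \<Rightarrow> (nat \<Rightarrow> nat \<Rightarrow> 'a :: ring_1) \<Rightarrow> nat \<Rightarrow> (nat \<Rightarrow> 'a) set" where
  "rspan n q j = {v. \<exists>c. \<forall>r<n. v r = (\<Sum>k<j. q k r * c k)}"

lemma rspanI: "(\<And>r. r < n \<Longrightarrow> v r = (\<Sum>k<j. q k r * c k)) \<Longrightarrow> v \<in> rspan n q j"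
  unfolding rspan_def by blast

lemma rspan_mono:
  assumes "v \<in> rspan n q j" "j \<le> j'"
  shows "v \<in> rspan n q j'"
proof -
  obtain c where c: "\<And>r. r < n \<Longrightarrow> v r = (\<Sum>k<j. q k r * c k)"
    using assms(1) by (auto simp: rspan_def)
  have "(\<Sum>k<j'. q k r * (if k < j then c k else 0)) = (\<Sum>k<j. q k r * c k)" for r
    using assms(2) by (intro sum.mono_neutral_cong_right) auto
  then show ?thesis using c by (auto simp: rspan_def intro!: exI[of _ "\<lambda>k. if k < j then c k else 0"])
qed

lemma rspan_trans:
  assumes "v \<in> rspan n p m" "\<And>k. k < m \<Longrightarrow> p k \<in> rspan n q j"
  shows "v \<in> rspan n q j"
proof -
  obtain c where c: "\<And>r. r < n \<Longrightarrow> v r = (\<Sum>k<m. p k r * c k)"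
    using assms(1) by (auto simp: rspan_def)
  have "\<forall>k. \<exists>b. k < m \<longrightarrow> (\<forall>r<n. p k r = (\<Sum>l<j. q l r * b l))"
    using assms(2) by (auto simp: rspan_def)
  then obtain b where b: "\<And>k r. k < m \<Longrightarrow> r < n \<Longrightarrow> p k r = (\<Sum>l<j. q l r * b k l)" by metis
  have "v r = (\<Sum>l<j. q l r * (\<Sum>k<m. b k l * c k))" if "r < n" for r
  proof -
    have "v r = (\<Sum>k<m. \<Sum>l<j. q l r * (b k l * c k))"
      using c that b by (simp add: sum_distrib_right mult.assoc)
    also have "\<dots> = (\<Sum>l<j. \<Sum>k<m. q l r * (b k l * c k))" by (rule sum.swap)
    finally show ?thesis by (simp add: sum_distrib_left)
  qed
  then show ?thesis by (auto simp: rspan_def)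
qed

lemma rspan_cong: "\<lbrakk>\<And>k. k < j \<Longrightarrow> p k = q k\<rbrakk> \<Longrightarrow> rspan n p j = rspan n q j"
  by (simp add: rspan_def)

text \<open>Column \<open>k\<close> has its pivot in row \<open>\<pi> k\<close>. For
  \<open>j = n\<close>, with the rows in the order \<open>\<pi>\<close>, \<open>L\<close> is lower
  unitriangular. The \<open>rspan\<close> conditions say that \<open>L\<close> and \<open>q\<close>
  span the same flag, so a complete flag costs only n(n-1)/2 free entries. Scalars act on the right,
  so that matrices act linearly from the left.\<close>

definition echelon ::
  "nat \<Rightarrow> (nat \<Rightarrow> nat \<Rightarrow> 'a :: ring_1) \<Rightarrow> (nat \<Rightarrow> nat \<Rightarrow> 'a) \<Rightarrow> (nat \<Rightarrow> nat) \<Rightarrow> nat \<Rightarrow> bool" where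
  "echelon n q L \<pi> j \<longleftrightarrow> inj_on \<pi> {..<j} \<and> \<pi> ` {..<j} \<subseteq> {..<n} \<and>
     (\<forall>k<j. L k (\<pi> k) = 1 \<and> (\<forall>i<k. L k (\<pi> i) = 0) \<and>
        L k \<in> rspan n q (Suc k) \<and> q k \<in> rspan n L (Suc k))"

lemma echelonD:
  assumes "echelon n q L \<pi> j"
  shows "inj_on \<pi> {..<j}" "\<pi> ` {..<j} \<subseteq> {..<n}"
    "k < j \<Longrightarrow> L k (\<pi> k) = 1" "k < j \<Longrightarrow> i < k \<Longrightarrow> L k (\<pi> i) = 0"
    "k < j \<Longrightarrow> L k \<in> rspan n q (Suc k)" "k < j \<Longrightarrow> q k \<in> rspan n L (Suc k)"
  using assms unfolding echelon_def by blast+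

text \<open>Column reduction without column exchanges: it keeps the flag spanned by the columns.\<close>

lemma echelon_exists:
  fixes q :: "nat \<Rightarrow> nat \<Rightarrow> 'a :: division_ring"
  assumes indep: "\<And>c k. \<forall>r<n. (\<Sum>k<n. q k r * c k) = 0 \<Longrightarrow> k < n \<Longrightarrow> c k = 0"
    and "j \<le> n"
  shows "\<exists>L \<pi>. echelon n q L \<pi> j"
  using \<open>j \<le> n\<close>
proof (induction j)
  case 0
  show ?case by (auto simp: echelon_def)
next
  case (Suc j)
  then obtain L \<pi> where E: "echelon n q L \<pi> j" by auto
  note inj = echelonD(1)[OF E] and img = echelonD(2)[OF E] and one = echelonD(3)[OF E]
    and zero = echelonD(4)[OF E] and Lq = echelonD(5)[OF E] and qL = echelonD(6)[OF E]
  \<comment> \<open>Subtracting this combination clears the earlier pivot rows of column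
    \<open>j\<close>. If the rest \<open>w\<close> is nonzero, any row where it does not vanish can
    be the next pivot.\<close>
  obtain c where c: "\<And>i. i < j \<Longrightarrow> (\<Sum>k<j. L k (\<pi> i) * c k) = q j (\<pi> i)"
    using forward_substitution[of j "\<lambda>i k. L k (\<pi> i)" "\<lambda>i. q j (\<pi> i)"] one zero by auto
  define w where "w r = q j r - (\<Sum>k<j. L k r * c k)" for r
  have w0: "w (\<pi> i) = 0" if "i < j" for i using c that by (simp add: w_def)
  have spanL: "(\<lambda>r. \<Sum>k<j. L k r * c k) \<in> rspan n q j"
    by (rule rspan_trans[of _ n L j])
      (auto simp: rspan_def[of n L] intro!: rspan_mono[OF Lq])
  then obtain b where b: "\<And>r. r < n \<Longrightarrow> (\<Sum>k<j. L k r * c k) = (\<Sum>k<j. q k r * b k)"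
    by (auto simp: rspan_def)
  \<comment> \<open>Otherwise column \<open>j\<close> would be a combination of the earlier columns
    of \<open>q\<close>; \<open>a\<close> below is the resulting linear relation.\<close>
  have "\<exists>r<n. w r \<noteq> 0"
  proof (rule ccontr)
    assume "\<not> (\<exists>r<n. w r \<noteq> 0)"
    then have eq: "q j r = (\<Sum>k<j. q k r * b k)" if "r < n" for r
      using b[OF that] that by (auto simp: w_def)
    define a where "a k = (if k < j then - b k else if k = j then 1 else 0)" for k
    have "(\<Sum>k<n. q k r * a k) = 0" if "r < n" for r
    proof -
      have "(\<Sum>k<n. q k r * a k) = (\<Sum>k<Suc j. q k r * a k)"
        using Suc.prems by (intro sum.mono_neutral_right) (auto simp: a_def)
      also have "(\<Sum>k<j. q k r * a k) = - (\<Sum>k<j. q k r * b k)"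
        by (simp add: a_def sum_negf)
      then have "(\<Sum>k<Suc j. q k r * a k) = 0" using eq[OF that] by (simp add: a_def)
      finally show ?thesis .
    qed
    then have "a j = 0" using Suc.prems by (intro indep) auto
    then show False by (simp add: a_def)
  qed
  then obtain p where p: "p < n" "w p \<noteq> 0" by blast
  have p_new: "p \<notin> \<pi> ` {..<j}" using p(2) w0 by auto
  \<comment> \<open>Scaling on the right makes the pivot 1 without changing the right span.\<close>
  define L' where "L' = L(j := (\<lambda>r. w r * inverse (w p)))"
  define \<pi>' where "\<pi>' = \<pi>(j := p)"
  have span_eq: "rspan n L' k = rspan n L k" if "k \<le> j" for k
    by (rule rspan_cong) (use that in \<open>auto simp: L'_def\<close>)
  have "L' j \<in> rspan n q (Suc j)"
  proof -
    have "L' j r = (\<Sum>k<Suc j. q k r * (if k = j then inverse (w p) else - b k * inverse (w p)))"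
      if "r < n" for r
    proof -
      have "(\<Sum>k<Suc j. q k r * (if k = j then inverse (w p) else - b k * inverse (w p))) =
          (\<Sum>k<j. q k r * (- b k * inverse (w p))) + q j r * inverse (w p)"
        by simp
      also have "(\<Sum>k<j. q k r * (- b k * inverse (w p))) = - (\<Sum>k<j. q k r * b k) * inverse (w p)"
        by (simp add: sum_negf sum_distrib_right mult.assoc)
      finally have "(\<Sum>k<Suc j. q k r * (if k = j then inverse (w p) else - b k * inverse (w p))) =
          (q j r - (\<Sum>k<j. q k r * b k)) * inverse (w p)" by (simp add: left_diff_distrib)
      moreover have "L' j r = (q j r - (\<Sum>k<j. q k r * b k)) * inverse (w p)"
        unfolding b[OF that, symmetric] by (simp add: L'_def flip: w_def)
      ultimately show ?thesis by simp
    qed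
    then show ?thesis by (rule rspanI)
  qed
  moreover have "q j \<in> rspan n L' (Suc j)"
  proof -
    have "q j r = (\<Sum>k<Suc j. L' k r * (if k = j then w p else c k))" for r
    proof -
      have "(\<Sum>k<j. L' k r * (if k = j then w p else c k)) = (\<Sum>k<j. L k r * c k)"
        by (rule sum.cong) (auto simp: L'_def)
      moreover have "L' j r * w p = w r" using p(2) by (simp add: L'_def mult.assoc)
      ultimately show ?thesis by (simp add: w_def[of r])
    qed
    then show ?thesis by (rule rspanI)
  qed
  moreover have "inj_on \<pi>' {..<Suc j}" "\<pi>' ` {..<Suc j} \<subseteq> {..<n}"
    using inj img p_new p(1) by (auto simp: \<pi>'_def lessThan_Suc inj_on_def)
  moreover have "L' k (\<pi>' k) = 1" if "k \<le> j" for k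
    using that one p(2) by (auto simp: L'_def \<pi>'_def)
  moreover have "L' k (\<pi>' i) = 0" if "k \<le> j" "i < k" for k i
    using that zero w0 by (auto simp: L'_def \<pi>'_def)
  moreover have "L' k \<in> rspan n q (Suc k)" "q k \<in> rspan n L' (Suc k)" if "k < j" for k
    using that Lq qL span_eq[of "Suc k"] by (auto simp: L'_def)
  ultimately have "echelon n q L' \<pi>' (Suc j)"
    unfolding echelon_def less_Suc_eq_le by (metis order.order_iff_strict)
  then show ?case by blast
qed

text \<open>\<open>(0, i, j, c)\<close> is coordinate \<open>c\<close> of the entry in row
  \<open>i\<close> and column \<open>j < i\<close> of the unitriangular matrix.
  \<open>(1, c, j, i)\<close> and \<open>(2, c, j, i)\<close> are coordinate \<open>c\<close> of the
  entry in row \<open>i\<close> and column \<open>j\<close>, on or above the diagonal, of the two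
  upper triangular ones. Both bounds use this index set.\<close>

definition param_index :: "nat \<Rightarrow> (nat \<times> nat \<times> nat \<times> nat) set" where
  "param_index n = {0} \<times> (SIGMA i:{..<n}. {..<i} \<times> {..<4}) \<union>
     {1, 2} \<times> {..<4} \<times> (SIGMA j:{..<n}. {..j})"

lemma card_param_index: "finite (param_index n)" "card (param_index n) = 2 * n * (3 * n + 1)"
proof -
  show "finite (param_index n)" by (auto simp: param_index_def)
  have "(\<Sum>i<n. i * 4) + 2 * (4 * (\<Sum>j<n. Suc j)) = 2 * n * (3 * n + 1)"
    by (induction n) (auto simp: algebra_simps)
  then show "card (param_index n) = 2 * n * (3 * n + 1)"
    unfolding param_index_def
    by (subst card_Un_disjoint) (auto simp: card_cartesian_product)
qed

section \<open>Quaternions with coordinates in a ring of integer polynomials\<close>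

definition quat_ring :: "real list \<Rightarrow> quat set" where
  "quat_ring ts = {q. \<forall>c<4. \<exists>p. quat_coord q c = pev p ts}"

lemma all_less_4: "(\<forall>c<4. P c) \<longleftrightarrow> P 0 \<and> P (Suc 0) \<and> P 2 \<and> P (3 :: nat)"
  by (simp add: numeral_eq_Suc All_less_Suc) auto

lemma quat_ring_iff:
  "q \<in> quat_ring ts \<longleftrightarrow> {qRe q, qI q, qJ q, qK q} \<subseteq> range (\<lambda>p. pev p ts)"
  by (auto simp: quat_ring_def all_less_4)

lemma range_pev_closed:
  fixes ts :: "'a :: comm_ring_1 list"
  assumes "x \<in> range (\<lambda>p. pev p ts)" "y \<in> range (\<lambda>p. pev p ts)"
  shows "x + y \<in> range (\<lambda>p. pev p ts)" "x - y \<in> range (\<lambda>p. pev p ts)"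
    "x * y \<in> range (\<lambda>p. pev p ts)"
proof -
  obtain p q where "x = pev p ts" "y = pev q ts" using assms by auto
  then have "x + y = pev (PA p q) ts" "x - y = pev (PA p (PM (PC (-1)) q)) ts" "x * y = pev (PM p q) ts"
    by auto
  then show "x + y \<in> range (\<lambda>p. pev p ts)" "x - y \<in> range (\<lambda>p. pev p ts)"
    "x * y \<in> range (\<lambda>p. pev p ts)" by blast+
qed

lemma range_pev_of_int: "of_int k \<in> range (\<lambda>p. pev p ts)"
  using rangeI[of "\<lambda>p. pev p ts" "PC k"] by simp

lemma quat_ring_closed:
  assumes "x \<in> quat_ring ts" "y \<in> quat_ring ts"
  shows "x + y \<in> quat_ring ts" "x - y \<in> quat_ring ts" "x * y \<in> quat_ring ts"
  using assms
  by (auto simp: quat_ring_iff plus_quat_def minus_quat_def times_quat_def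
      intro!: range_pev_closed simp del: image_iff)

lemma quat_ring_0_1: "0 \<in> quat_ring ts" "1 \<in> quat_ring ts"
  using range_pev_of_int[of 0 ts] range_pev_of_int[of 1 ts]
  by (auto simp: quat_ring_iff zero_quat_def one_quat_def)

lemma quat_ring_sum: "(\<And>i. i \<in> I \<Longrightarrow> g i \<in> quat_ring ts) \<Longrightarrow> sum g I \<in> quat_ring ts"
  by (induction I rule: infinite_finite_induct) (auto intro: quat_ring_0_1 quat_ring_closed)

text \<open>Solves \<open>A L = L T\<close> for \<open>A\<close> by columns, from the last pivot
  backwards: in equation \<open>j\<close> column \<open>\<pi> j\<close> of \<open>A\<close> has
  coefficient 1, and the other columns present belong to later pivots. Only ring operations occur,
  so the entries are polynomial in the parameters.\<close>

lemma entries_in_quat_ring: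
  fixes A :: "nat \<Rightarrow> nat \<Rightarrow> quat"
  assumes bij: "bij_betw \<pi> {..<n} {..<n}"
    and one: "\<And>k. k < n \<Longrightarrow> L k (\<pi> k) = 1" and zero: "\<And>k i. k < n \<Longrightarrow> i < k \<Longrightarrow> L k (\<pi> i) = 0"
    and L: "\<And>k i. k < i \<Longrightarrow> i < n \<Longrightarrow> L k (\<pi> i) \<in> quat_ring ts"
    and T: "\<And>k j. k \<le> j \<Longrightarrow> j < n \<Longrightarrow> T k j \<in> quat_ring ts"
    and eq: "\<And>r j. r < n \<Longrightarrow> j < n \<Longrightarrow> (\<Sum>s<n. A r s * L j s) = (\<Sum>k<Suc j. L k r * T k j)"
    and "r < n" "s < n"
  shows "A r s \<in> quat_ring ts"
proof -
  have L_all: "L k (\<pi> i) \<in> quat_ring ts" if "k < n" "i < n" for k i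
    using that one zero L quat_ring_0_1 by (metis linorder_neqE_nat)
  have pi_surj: "\<exists>i<n. s = \<pi> i" if "s < n" for s
    using that bij by (auto simp: bij_betw_def)
  have "A r (\<pi> j) \<in> quat_ring ts" if "j < n" for j
    using that
  proof (induction "n - j" arbitrary: j rule: less_induct)
    case (less j)
    have "(\<Sum>s<n. A r s * L j s) = (\<Sum>i<n. A r (\<pi> i) * L j (\<pi> i))"
      by (rule sum.reindex_bij_betw[OF bij, symmetric])
    also have "\<dots> = (\<Sum>i\<in>{j..<n}. A r (\<pi> i) * L j (\<pi> i))"
      using less.prems zero by (intro sum.mono_neutral_right) auto
    also have "\<dots> = A r (\<pi> j) + (\<Sum>i\<in>{Suc j..<n}. A r (\<pi> i) * L j (\<pi> i))"
      using less.prems one by (simp add: sum.atLeast_Suc_lessThan)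
    finally have A_eq: "A r (\<pi> j) = (\<Sum>k<Suc j. L k r * T k j) -
        (\<Sum>i\<in>{Suc j..<n}. A r (\<pi> i) * L j (\<pi> i))"
      using eq[OF \<open>r < n\<close> less.prems] by (simp add: algebra_simps)
    obtain i0 where i0: "i0 < n" "r = \<pi> i0" using pi_surj \<open>r < n\<close> by blast
    show ?case unfolding A_eq
      by (intro quat_ring_closed quat_ring_sum less.hyps)
        (use less.prems i0 L_all T in auto)
  qed
  then show ?thesis using pi_surj[OF \<open>s < n\<close>] by blast
qed

lemma times_mat_entry:
  fixes A B :: "'a :: semiring_0 mat"
  assumes "A \<in> carrier_mat n n" "B \<in> carrier_mat n n" "i < n" "j < n"
  shows "(A * B) $$ (i, j) = (\<Sum>k<n. A $$ (i, k) * B $$ (k, j))"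
  using assms by (auto simp: scalar_prod_def lessThan_atLeast0 intro!: sum.cong)

lemma mat_coords_quat_ring:
  assumes "\<And>r s. r < n \<Longrightarrow> s < n \<Longrightarrow> A $$ (r, s) \<in> quat_ring ts" "k < 4 * n\<^sup>2"
  shows "\<exists>p. mat_coords n A $ k = pev p ts"
proof -
  have d: "k div 4 < n * n" using assms(2)
    by (intro less_mult_imp_div_less) (simp add: power2_eq_square)
  then have "k div 4 div n < n" "n > 0" by (auto simp: less_mult_imp_div_less intro: gr0I)
  then have "A $$ (k div 4 div n, k div 4 mod n) \<in> quat_ring ts" using assms(1) by simp
  then show ?thesis using assms(2) by (simp add: mat_coords_def quat_ring_def)
qed

text \<open>Triangularity depends only on the flag spanned by the columns of \<open>Q\<close>, so
  \<open>Q\<close> may be replaced by its reduced form, which has fewer free entries.\<close>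

lemma simul_triang_param:
  assumes "y \<in> pair_coords n ` simul_triang n"
  shows "\<exists>ts. length ts = 2 * n * (3 * n + 1) \<and> (\<forall>i<8 * n\<^sup>2. \<exists>p. y $ i = pev p ts)"
proof -
  obtain A B P Q where y: "y = mat_coords n A @\<^sub>v mat_coords n B"
    and carr: "A \<in> carrier_mat n n" "B \<in> carrier_mat n n" "P \<in> carrier_mat n n" "Q \<in> carrier_mat n n"
    and inv: "P * Q = 1\<^sub>m n" "Q * P = 1\<^sub>m n"
    and tri: "upper_triangular (P * A * Q)" "upper_triangular (P * B * Q)"
    using assms by (auto simp: simul_triang_def pair_coords_def)
  define q where "q j r = Q $$ (r, j)" for j r
  have PQ_entry: "(\<Sum>k<n. P $$ (i, k) * q j k) = (if i = j then 1 else 0)" if "i < n" "j < n" for i j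
    using times_mat_entry[OF carr(3,4) that] that by (simp add: inv q_def)
  have indep: "c k = 0" if 0: "\<forall>r<n. (\<Sum>k<n. q k r * c k) = 0" and k: "k < n" for c k
  proof -
    have "c k = (\<Sum>j<n. (\<Sum>r<n. P $$ (k, r) * q j r) * c j)"
      using k by (simp add: PQ_entry if_distrib[of "\<lambda>x. x * _"] cong: if_cong)
    also have "\<dots> = (\<Sum>j<n. \<Sum>r<n. P $$ (k, r) * (q j r * c j))"
      by (simp add: sum_distrib_right mult.assoc)
    also have "\<dots> = (\<Sum>r<n. \<Sum>j<n. P $$ (k, r) * (q j r * c j))" by (rule sum.swap)
    also have "\<dots> = (\<Sum>r<n. P $$ (k, r) * (\<Sum>j<n. q j r * c j))" by (simp add: sum_distrib_left)
    finally show ?thesis using 0 by simp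
  qed
  obtain L \<pi> where E: "echelon n q L \<pi> n" using echelon_exists[of n q n] indep by blast
  have bij: "bij_betw \<pi> {..<n} {..<n}"
    using echelonD(1,2)[OF E] endo_inj_surj[of "{..<n}" \<pi>] by (simp add: bij_betw_def)
  \<comment> \<open>\<open>X Q = Q (P X Q)\<close> with an upper triangular factor says that
    \<open>X\<close> preserves the flag of \<open>Q\<close>. The columns \<open>L\<close> span the
    same flag, so \<open>X\<close> acts on them by an upper triangular matrix too.\<close>
  have flag: "\<exists>T. \<forall>r<n. \<forall>j<n. (\<Sum>s<n. X $$ (r, s) * L j s) = (\<Sum>k<Suc j. L k r * T k j)"
    if X: "X \<in> carrier_mat n n" "upper_triangular (P * X * Q)" for X
  proof -
    define T where "T = P * X * Q"
    have T: "T \<in> carrier_mat n n" using X(1) carr by (simp add: T_def)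
    have "Q * T = Q * (P * (X * Q))"
      unfolding T_def assoc_mult_mat[OF carr(3) X(1) carr(4)] by (rule refl)
    also have "\<dots> = Q * P * (X * Q)"
      by (rule assoc_mult_mat[OF carr(4,3) mult_carrier_mat[OF X(1) carr(4)], symmetric])
    also have "\<dots> = X * Q"
      unfolding inv by (rule left_mult_one_mat[OF mult_carrier_mat[OF X(1) carr(4)]])
    finally have "X * Q = Q * T" by (rule sym)
    then have XQ: "(\<Sum>s<n. X $$ (r, s) * q j s) = (\<Sum>k<n. q k r * T $$ (k, j))"
      if "r < n" "j < n" for r j
      using times_mat_entry[OF X(1) carr(4) that] times_mat_entry[OF carr(4) T that]
      by (simp add: q_def)
    have Xq: "(\<lambda>r. \<Sum>s<n. X $$ (r, s) * q j s) \<in> rspan n q (Suc j)" if "j < n" for j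
    proof -
      have "(\<Sum>k<n. q k r * T $$ (k, j)) = (\<Sum>k<Suc j. q k r * T $$ (k, j))" if "r < n" for r
        using \<open>j < n\<close> X(2) T by (intro sum.mono_neutral_right) (auto simp: T_def upper_triangular_def)
      then show ?thesis using XQ that by (auto simp: rspan_def intro!: exI[of _ "\<lambda>k. T $$ (k, j)"])
    qed
    have "\<exists>t. \<forall>r<n. (\<Sum>s<n. X $$ (r, s) * L j s) = (\<Sum>k<Suc j. L k r * t k)" if j: "j < n" for j
    proof -
      obtain b where b: "\<And>s. s < n \<Longrightarrow> L j s = (\<Sum>k<Suc j. q k s * b k)"
        using echelonD(5)[OF E j] unfolding rspan_def by blast
      have "(\<Sum>s<n. X $$ (r, s) * L j s) = (\<Sum>k<Suc j. (\<Sum>s<n. X $$ (r, s) * q k s) * b k)" for r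
      proof -
        have "(\<Sum>s<n. X $$ (r, s) * L j s) = (\<Sum>s<n. \<Sum>k<Suc j. X $$ (r, s) * q k s * b k)"
          by (intro sum.cong refl) (simp add: b sum_distrib_left mult.assoc del: sum.lessThan_Suc)
        also have "\<dots> = (\<Sum>k<Suc j. \<Sum>s<n. X $$ (r, s) * q k s * b k)" by (rule sum.swap)
        finally show ?thesis by (simp add: sum_distrib_right del: sum.lessThan_Suc)
      qed
      then have "(\<lambda>r. \<Sum>s<n. X $$ (r, s) * L j s) \<in>
          rspan n (\<lambda>k r. \<Sum>s<n. X $$ (r, s) * q k s) (Suc j)"
        by (rule rspanI)
      then have "(\<lambda>r. \<Sum>s<n. X $$ (r, s) * L j s) \<in> rspan n q (Suc j)"
        by (rule rspan_trans) (rule rspan_mono[OF Xq], use j in simp_all)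
      then have "(\<lambda>r. \<Sum>s<n. X $$ (r, s) * L j s) \<in> rspan n L (Suc j)"
      proof (rule rspan_trans)
        fix k assume "k < Suc j"
        then show "q k \<in> rspan n L (Suc j)"
          using j by (intro rspan_mono[OF echelonD(6)[OF E]]) simp_all
      qed
      then show ?thesis unfolding rspan_def by blast
    qed
    then have "\<forall>j. \<exists>t. j < n \<longrightarrow> (\<forall>r<n. (\<Sum>s<n. X $$ (r, s) * L j s) = (\<Sum>k<Suc j. L k r * t k))"
      by blast
    from choice[OF this] obtain t where t: "\<And>j r. j < n \<Longrightarrow> r < n \<Longrightarrow>
        (\<Sum>s<n. X $$ (r, s) * L j s) = (\<Sum>k<Suc j. L k r * t j k)" by blast
    show ?thesis
      by (rule exI[of _ "\<lambda>k j. t j k"], intro allI impI) (rule t)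
  qed
  obtain T where T: "\<And>r j. r < n \<Longrightarrow> j < n \<Longrightarrow> (\<Sum>s<n. A $$ (r, s) * L j s) = (\<Sum>k<Suc j. L k r * T k j)"
    using flag[OF carr(1) tri(1)] by blast
  obtain U where U: "\<And>r j. r < n \<Longrightarrow> j < n \<Longrightarrow> (\<Sum>s<n. B $$ (r, s) * L j s) = (\<Sum>k<Suc j. L k r * U k j)"
    using flag[OF carr(2) tri(2)] by blast
  define val where "val = (\<lambda>(m :: nat, a, b, c). if m = 0 then quat_coord (L b (\<pi> a)) c
    else if m = 1 then quat_coord (T c b) a else quat_coord (U c b) a)"
  obtain idx where idx: "set idx = param_index n" "distinct idx"
    using finite_distinct_list[OF card_param_index(1)] by blast
  define ts where "ts = map val idx"
  have len_ts: "length ts = 2 * n * (3 * n + 1)"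
    using idx distinct_card[of idx] card_param_index(2)[of n] by (simp add: ts_def)
  have val: "\<exists>p. val i = pev p ts" if "i \<in> param_index n" for i
    using that idx(1) by (intro pev_in_set) (auto simp: ts_def)
  have L_ring: "L k (\<pi> i) \<in> quat_ring ts" if "k < i" "i < n" for k i
    unfolding quat_ring_def
  proof (intro CollectI allI impI)
    fix c :: nat assume "c < 4"
    then show "\<exists>p. quat_coord (L k (\<pi> i)) c = pev p ts"
      using val[of "(0, i, k, c)"] that by (auto simp: param_index_def val_def)
  qed
  have T_ring: "T k j \<in> quat_ring ts" if "k \<le> j" "j < n" for k j
    unfolding quat_ring_def
  proof (intro CollectI allI impI)
    fix c :: nat assume "c < 4"
    then show "\<exists>p. quat_coord (T k j) c = pev p ts"
      using val[of "(1, c, j, k)"] that by (auto simp: param_index_def val_def)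
  qed
  have U_ring: "U k j \<in> quat_ring ts" if "k \<le> j" "j < n" for k j
    unfolding quat_ring_def
  proof (intro CollectI allI impI)
    fix c :: nat assume "c < 4"
    then show "\<exists>p. quat_coord (U k j) c = pev p ts"
      using val[of "(2, c, j, k)"] that by (auto simp: param_index_def val_def)
  qed
  have ringA: "A $$ (r, s) \<in> quat_ring ts" if "r < n" "s < n" for r s
    by (rule entries_in_quat_ring[where A = "\<lambda>r s. A $$ (r, s)" and L = L and T = T and \<pi> = \<pi>])
      (rule bij echelonD(3,4)[OF E] L_ring T_ring T that; assumption?)+
  have ringB: "B $$ (r, s) \<in> quat_ring ts" if "r < n" "s < n" for r s
    by (rule entries_in_quat_ring[where A = "\<lambda>r s. B $$ (r, s)" and L = L and T = U and \<pi> = \<pi>])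
      (rule bij echelonD(3,4)[OF E] L_ring U_ring U that; assumption?)+
  have "\<exists>p. y $ i = pev p ts" if "i < 8 * n\<^sup>2" for i
  proof (cases "i < 4 * n\<^sup>2")
    case True
    then have "y $ i = mat_coords n A $ i" by (simp add: y mat_coords_def)
    then show ?thesis using mat_coords_quat_ring[OF ringA True] by simp
  next
    case False
    then have "y $ i = mat_coords n B $ (i - 4 * n\<^sup>2)" "i - 4 * n\<^sup>2 < 4 * n\<^sup>2"
      using that by (simp_all add: y mat_coords_def)
    then show ?thesis using mat_coords_quat_ring[OF ringB] by simp
  qed
  then show ?thesis using len_ts by blast
qed

section \<open>An injective chart\<close>

definition lower_unitriangular :: "nat \<Rightarrow> 'a :: ring_1 mat \<Rightarrow> bool" where
  "lower_unitriangular n L \<longleftrightarrow> L \<in> carrier_mat n n \<and> (\<forall>i<n. L $$ (i, i) = 1) \<and>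
     (\<forall>i j. i < j \<longrightarrow> j < n \<longrightarrow> L $$ (i, j) = 0)"

lemma lower_unitriangularD:
  assumes "lower_unitriangular n L"
  shows "L \<in> carrier_mat n n" "i < n \<Longrightarrow> L $$ (i, i) = 1" "i < j \<Longrightarrow> j < n \<Longrightarrow> L $$ (i, j) = 0"
  using assms by (auto simp: lower_unitriangular_def)

lemma lower_unitriangular_right_inverse:
  assumes L: "lower_unitriangular n L"
  shows "\<exists>M. lower_unitriangular n M \<and> L * M = 1\<^sub>m n"
proof -
  note Lc = lower_unitriangularD(1)[OF L] and one = lower_unitriangularD(2)[OF L]
    and zero = lower_unitriangularD(3)[OF L]
  have "\<forall>j. \<exists>c. \<forall>i<n. (\<Sum>k<n. L $$ (i, k) * c k) = (if i = j then 1 else 0)"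
    by (intro allI forward_substitution) (simp_all add: one zero)
  from choice[OF this] obtain C where
    C: "\<And>j i. i < n \<Longrightarrow> (\<Sum>k<n. L $$ (i, k) * C j k) = (if i = j then 1 else 0)" by blast
  define M where "M = mat n n (\<lambda>(i, j). C j i)"
  have M: "M \<in> carrier_mat n n" by (simp add: M_def)
  have LM: "L * M = 1\<^sub>m n"
  proof (rule eq_matI)
    fix i j assume "i < dim_row (1\<^sub>m n :: 'a mat)" "j < dim_col (1\<^sub>m n :: 'a mat)"
    then have ij: "i < n" "j < n" by auto
    have "(L * M) $$ (i, j) = (\<Sum>k<n. L $$ (i, k) * C j k)"
      unfolding times_mat_entry[OF Lc M ij] using ij by (intro sum.cong) (auto simp: M_def)
    then show "(L * M) $$ (i, j) = 1\<^sub>m n $$ (i, j)" using C[OF ij(1), of j] ij by simp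
  qed (use Lc M in auto)
  \<comment> \<open>Row \<open>i\<close> of \<open>L M = 1\<close> expresses
    \<open>M $$ (i, j)\<close> through higher entries of column \<open>j\<close>; they vanish by
    induction because \<open>i \<le> j\<close>.\<close>
  have "M $$ (i, j) = (if i = j then 1 else 0)" if "i \<le> j" "j < n" for i j
    using that
  proof (induction i rule: less_induct)
    case (less i)
    have "(\<Sum>k<n. L $$ (i, k) * M $$ (k, j)) = (\<Sum>k\<in>{i}. L $$ (i, k) * M $$ (k, j))"
    proof (rule sum.mono_neutral_right)
      show "\<forall>k\<in>{..<n} - {i}. L $$ (i, k) * M $$ (k, j) = 0"
      proof
        fix k assume k: "k \<in> {..<n} - {i}"
        then have "L $$ (i, k) = 0 \<or> M $$ (k, j) = 0"
          using less zero[of i k] by (cases "k < i") auto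
        then show "L $$ (i, k) * M $$ (k, j) = 0" by auto
      qed
    qed (use less in auto)
    moreover have "(\<Sum>k<n. L $$ (i, k) * M $$ (k, j)) = (if i = j then 1 else 0)"
      using times_mat_entry[OF Lc M, of i j] less.prems unfolding LM by simp
    ultimately show ?case using one[of i] less.prems by simp
  qed
  then have "lower_unitriangular n M" using M unfolding lower_unitriangular_def by simp
  then show ?thesis using LM by blast
qed

text \<open>The right inverse \<open>M\<close> has a right inverse \<open>K\<close> in turn, and
  \<open>L = L M K = K\<close>, so \<open>M\<close> is two-sided.\<close>

lemma lower_unitriangular_inverse:
  assumes L: "lower_unitriangular n L"
  shows "\<exists>M. lower_unitriangular n M \<and> L * M = 1\<^sub>m n \<and> M * L = 1\<^sub>m n"
proof -
  obtain M where M: "lower_unitriangular n M" "L * M = 1\<^sub>m n"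
    using lower_unitriangular_right_inverse[OF L] by blast
  obtain K where K: "lower_unitriangular n K" "M * K = 1\<^sub>m n"
    using lower_unitriangular_right_inverse[OF M(1)] by blast
  note c = lower_unitriangularD(1)[OF L] lower_unitriangularD(1)[OF M(1)]
    lower_unitriangularD(1)[OF K(1)]
  have "L = L * (M * K)" unfolding K(2) by (rule right_mult_one_mat[OF c(1), symmetric])
  also have "\<dots> = L * M * K" by (rule assoc_mult_mat[OF c, symmetric])
  also have "\<dots> = K" unfolding M(2) by (rule left_mult_one_mat[OF c(3)])
  finally show ?thesis using M K by blast
qed

lemma lower_unitriangular_mult:
  assumes K: "lower_unitriangular n K" and L: "lower_unitriangular n L"
  shows "lower_unitriangular n (K * L)"
proof -
  note c = lower_unitriangularD(1)[OF K] lower_unitriangularD(1)[OF L]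
  have "(K * L) $$ (i, j) = (if i = j then 1 else 0)" if ij: "i \<le> j" "j < n" for i j
  proof -
    have "(K * L) $$ (i, j) = (\<Sum>k<n. K $$ (i, k) * L $$ (k, j))"
      using times_mat_entry[OF c] ij by simp
    also have "\<dots> = (\<Sum>k<n. if k = i \<and> i = j then 1 else 0)"
    proof (rule sum.cong[OF refl])
      fix k assume "k \<in> {..<n}"
      then consider "k < j" | "i < k" "k < n" | "k = i" "j = i" using ij by force
      then show "K $$ (i, k) * L $$ (k, j) = (if k = i \<and> i = j then 1 else 0)"
        using lower_unitriangularD(2,3)[OF K] lower_unitriangularD(2,3)[OF L] ij
        by cases auto
    qed
    also have "\<dots> = (if i = j then 1 else 0)" using ij by auto
    finally show ?thesis .
  qed
  then show ?thesis using c by (auto simp: lower_unitriangular_def)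
qed

lemma qRe_mult_commute: "qRe (x * y) = qRe (y * x)"
  by (simp add: times_quat_def algebra_simps)

text \<open>The real part behaves like a trace, so conjugate quaternions have the same one.\<close>

lemma qRe_conj:
  assumes "q * a = b * q" "q \<noteq> 0"
  shows "qRe a = qRe b"
proof -
  have "a = inverse q * (b * q)" using assms by (simp flip: assms(1) mult.assoc)
  then have "qRe a = qRe (b * q * inverse q)" using qRe_mult_commute by metis
  then show ?thesis using assms(2) by (simp add: mult.assoc)
qed

text \<open>The entries below the diagonal are cleared column by column from the left, and in each
  column from the bottom up. By then entry \<open>(i, j)\<close> of \<open>N T = T' N\<close> has
  shrunk to \<open>N $$ (i, j) * T $$ (j, j) = T' $$ (i, i) * N $$ (i, j)\<close>, and a nonzero
  \<open>N $$ (i, j)\<close> would make two diagonal entries with different real parts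
  conjugate.\<close>

lemma upper_triangular_intertwiner:
  assumes N: "lower_unitriangular n N"
    and T: "T \<in> carrier_mat n n" "upper_triangular T"
    and T': "T' \<in> carrier_mat n n" "upper_triangular T'"
    and eq: "N * T = T' * N"
    and re: "\<And>i j. j < i \<Longrightarrow> i < n \<Longrightarrow> qRe (T $$ (j, j)) \<noteq> qRe (T' $$ (i, i))"
  shows "N = 1\<^sub>m n"
proof -
  note Nc = lower_unitriangularD(1)[OF N]
  have T0: "T $$ (k, j) = 0" if "j < k" "k < n" for k j
    using that T by (auto simp: upper_triangular_def)
  have T'0: "T' $$ (k, j) = 0" if "j < k" "k < n" for k j
    using that T' by (auto simp: upper_triangular_def)
  have below: "N $$ (i, j) = 0" if "j < i" "i < n" for i j
    using that
  proof (induction j arbitrary: i rule: less_induct)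
    case (less j)
    note IH1 = less.IH
    show ?case using less.prems
    proof (induction "n - i" arbitrary: i rule: less_induct)
      case (less i)
      have "(\<Sum>k<n. N $$ (i, k) * T $$ (k, j)) = (\<Sum>k\<in>{j}. N $$ (i, k) * T $$ (k, j))"
      proof (rule sum.mono_neutral_right)
        show "\<forall>k\<in>{..<n} - {j}. N $$ (i, k) * T $$ (k, j) = 0"
        proof
          fix k assume k: "k \<in> {..<n} - {j}"
          then have "N $$ (i, k) = 0 \<or> T $$ (k, j) = 0"
            using less.prems IH1[of k i] T0[of j k] by (cases "k < j") auto
          then show "N $$ (i, k) * T $$ (k, j) = 0" by auto
        qed
      qed (use less.prems in auto)
      moreover have "(\<Sum>k<n. T' $$ (i, k) * N $$ (k, j)) = (\<Sum>k\<in>{i}. T' $$ (i, k) * N $$ (k, j))"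
      proof (rule sum.mono_neutral_right)
        show "\<forall>k\<in>{..<n} - {i}. T' $$ (i, k) * N $$ (k, j) = 0"
        proof
          fix k assume k: "k \<in> {..<n} - {i}"
          then consider "k < i" | "i < k" "k < n" by force
          then have "T' $$ (i, k) = 0 \<or> N $$ (k, j) = 0"
            using less.prems less.hyps[of k] T'0[of k i] diff_less_mono2[of i k n] by cases auto
          then show "T' $$ (i, k) * N $$ (k, j) = 0" by auto
        qed
      qed (use less.prems in auto)
      moreover have "(\<Sum>k<n. N $$ (i, k) * T $$ (k, j)) = (\<Sum>k<n. T' $$ (i, k) * N $$ (k, j))"
        using times_mat_entry[OF Nc T(1), of i j] times_mat_entry[OF T'(1) Nc, of i j] eq less.prems
        by simp
      ultimately have "N $$ (i, j) * T $$ (j, j) = T' $$ (i, i) * N $$ (i, j)" by simp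
      then show "N $$ (i, j) = 0" using qRe_conj re less.prems by blast
    qed
  qed
  show ?thesis
  proof (rule eq_matI)
    fix i j assume "i < dim_row (1\<^sub>m n :: quat mat)" "j < dim_col (1\<^sub>m n :: quat mat)"
    then have ij: "i < n" "j < n" by auto
    then show "N $$ (i, j) = 1\<^sub>m n $$ (i, j)"
      using below[of j i] lower_unitriangularD(2,3)[OF N] by (cases i j rule: linorder_cases) auto
  qed (use Nc in auto)
qed

section \<open>Polynomial conditions on quaternionic entries\<close>

definition qentry :: "real vec \<Rightarrow> (nat \<Rightarrow> nat) \<Rightarrow> quat" where
  "qentry z g = Quat (z $ g 0) (z $ g (Suc 0)) (z $ g 2) (z $ g 3)"

definition quat_poly :: "nat \<Rightarrow> (real vec \<Rightarrow> quat) \<Rightarrow> bool" where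
  "quat_poly m F \<longleftrightarrow> (\<lambda>z. qRe (F z)) \<in> poly_fun m \<and> (\<lambda>z. qI (F z)) \<in> poly_fun m \<and>
     (\<lambda>z. qJ (F z)) \<in> poly_fun m \<and> (\<lambda>z. qK (F z)) \<in> poly_fun m"

lemma poly_fun_diff:
  assumes "p \<in> poly_fun m" "q \<in> poly_fun m"
  shows "(\<lambda>x. p x - q x) \<in> poly_fun m"
  using poly_fun.add[OF assms(1) poly_fun.mult[OF poly_fun.const[of "- 1"] assms(2)]] by simp

lemma quat_poly_const: "quat_poly m (\<lambda>z. q)"
  by (simp add: quat_poly_def poly_fun.const)

lemma quat_poly_qentry: "(\<And>c. c < 4 \<Longrightarrow> g c < m) \<Longrightarrow> quat_poly m (\<lambda>z. qentry z g)"
  by (simp add: quat_poly_def qentry_def poly_fun.coord)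

lemma quat_poly_add: "quat_poly m F \<Longrightarrow> quat_poly m G \<Longrightarrow> quat_poly m (\<lambda>z. F z + G z)"
  by (simp add: quat_poly_def plus_quat_def poly_fun.add)

lemma quat_poly_diff: "quat_poly m F \<Longrightarrow> quat_poly m G \<Longrightarrow> quat_poly m (\<lambda>z. F z - G z)"
  by (simp add: quat_poly_def minus_quat_def poly_fun_diff)

lemma quat_poly_mult: "quat_poly m F \<Longrightarrow> quat_poly m G \<Longrightarrow> quat_poly m (\<lambda>z. F z * G z)"
  by (simp add: quat_poly_def times_quat_def poly_fun.add poly_fun.mult poly_fun_diff)

lemma quat_poly_sum:
  "(\<And>i. i \<in> I \<Longrightarrow> quat_poly m (F i)) \<Longrightarrow> quat_poly m (\<lambda>z. \<Sum>i\<in>I. F i z)"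
  by (induction I rule: infinite_finite_induct) (auto intro: quat_poly_const quat_poly_add)

lemma semialgebraic_Ball:
  assumes "finite I" "\<And>i. i \<in> I \<Longrightarrow> semialgebraic m {z \<in> carrier_vec m. P i z}"
  shows "semialgebraic m {z \<in> carrier_vec m. \<forall>i\<in>I. P i z}"
  using assms
proof (induction I)
  case empty
  show ?case using semialgebraic.pos[OF poly_fun.const[of 1]] by simp
next
  case (insert i I)
  have "semialgebraic m ({z \<in> carrier_vec m. P i z} \<inter> {z \<in> carrier_vec m. \<forall>i\<in>I. P i z})"
    using insert by (intro semialgebraic.inter) auto
  also have "{z \<in> carrier_vec m. P i z} \<inter> {z \<in> carrier_vec m. \<forall>i\<in>I. P i z} =
      {z \<in> carrier_vec m. \<forall>i\<in>insert i I. P i z}" by auto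
  finally show ?case .
qed

lemma semialgebraic_conj:
  assumes "semialgebraic m {z \<in> carrier_vec m. P z}" "semialgebraic m {z \<in> carrier_vec m. Q z}"
  shows "semialgebraic m {z \<in> carrier_vec m. P z \<and> Q z}"
proof -
  have "{z \<in> carrier_vec m. P z \<and> Q z} = {z \<in> carrier_vec m. P z} \<inter> {z \<in> carrier_vec m. Q z}"
    by auto
  then show ?thesis using semialgebraic.inter[OF assms] by simp
qed

lemma semialgebraic_quat_zero:
  assumes "quat_poly m F"
  shows "semialgebraic m {z \<in> carrier_vec m. F z = 0}"
proof -
  have "semialgebraic m {z \<in> carrier_vec m. qRe (F z) = 0 \<and> qI (F z) = 0 \<and> qJ (F z) = 0 \<and> qK (F z) = 0}"
    using assms unfolding quat_poly_def
    by (intro semialgebraic_conj) (auto intro: semialgebraic_zero_set)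
  then show ?thesis by (simp add: quat_eq_iff zero_quat_def)
qed

text \<open>The coordinates of a point of the cube are the entries of a lower unitriangular matrix and of
  two upper triangular ones, arranged by \<open>h\<close>. The shift by \<open>i\<close> makes the real parts of the diagonal
  entries increase, so that no two of them are conjugate.\<close>

definition lower_entry :: "(nat \<times> nat \<times> nat \<times> nat \<Rightarrow> nat) \<Rightarrow> real vec \<Rightarrow> nat \<Rightarrow> nat \<Rightarrow> quat" where
  "lower_entry h z i j = (if i = j then 1 else if j < i then qentry z (\<lambda>c. h (0, i, j, c)) else 0)"

definition upper_entry ::
  "(nat \<times> nat \<times> nat \<times> nat \<Rightarrow> nat) \<Rightarrow> nat \<Rightarrow> real vec \<Rightarrow> nat \<Rightarrow> nat \<Rightarrow> quat" where
  "upper_entry h m z i j = (if i \<le> j then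
     Quat (if i = j then real i else 0) 0 0 0 + qentry z (\<lambda>c. h (m, c, j, i)) else 0)"

lemma param_index_mem:
  "j < i \<Longrightarrow> i < n \<Longrightarrow> c < 4 \<Longrightarrow> (0, i, j, c) \<in> param_index n"
  "i \<le> j \<Longrightarrow> j < n \<Longrightarrow> c < 4 \<Longrightarrow> m = 1 \<or> m = 2 \<Longrightarrow> (m, c, j, i) \<in> param_index n"
  by (auto simp: param_index_def)

lemma qentry_cong: "(\<And>c. c < 4 \<Longrightarrow> y $ f c = z $ g c) \<Longrightarrow> qentry y f = qentry z g"
  by (simp add: qentry_def)

lemma qentry_eqD: "qentry y g = qentry z g \<Longrightarrow> c < 4 \<Longrightarrow> y $ g c = z $ g c"
  using all_less_4[of "\<lambda>c. y $ g c = z $ g c"] by (simp add: qentry_def)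

lemma qentry_mat_coords:
  assumes "i < n" "j < n"
  shows "qentry (mat_coords n A) (\<lambda>c. 4 * (i * n + j) + c) = A $$ (i, j)"
proof -
  have "mat_coords n A $ (4 * (i * n + j) + c) = quat_coord (A $$ (i, j)) c" if "c < 4" for c
    by (rule mat_coords_index(2)[OF assms that])
  from this[of 0] this[of "Suc 0"] this[of 2] this[of 3] show ?thesis
    by (simp only: qentry_def quat_eq_iff quat.sel quat_coord_simps)
qed

section \<open>The chart, its injectivity and its graph\<close>

locale triangular_chart =
  fixes n d :: nat and h :: "nat \<times> nat \<times> nat \<times> nat \<Rightarrow> nat"
  assumes h: "bij_betw h (param_index n) {0..<d}"
begin

definition Lm :: "real vec \<Rightarrow> quat mat" where
  "Lm z = mat n n (\<lambda>(i, j). lower_entry h z i j)"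

definition Tm :: "nat \<Rightarrow> real vec \<Rightarrow> quat mat" where
  "Tm m z = mat n n (\<lambda>(i, j). upper_entry h m z i j)"

definition Mm :: "real vec \<Rightarrow> quat mat" where
  "Mm z = (SOME M. lower_unitriangular n M \<and> Lm z * M = 1\<^sub>m n \<and> M * Lm z = 1\<^sub>m n)"

definition chart :: "real vec \<Rightarrow> real vec" where
  "chart z = pair_coords n (Lm z * Tm 1 z * Mm z, Lm z * Tm 2 z * Mm z)"

lemma h_less: "p \<in> param_index n \<Longrightarrow> h p < d"
  using h by (auto simp: bij_betw_def)

lemma Lm: "lower_unitriangular n (Lm z)"
  by (auto simp: lower_unitriangular_def Lm_def lower_entry_def)

lemma Tm: "Tm m z \<in> carrier_mat n n" "upper_triangular (Tm m z)"
  by (auto simp: Tm_def upper_triangular_def upper_entry_def)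

lemma Mm: "lower_unitriangular n (Mm z)" "Lm z * Mm z = 1\<^sub>m n" "Mm z * Lm z = 1\<^sub>m n"
  unfolding Mm_def using someI_ex[OF lower_unitriangular_inverse[OF Lm]] by blast+

lemmas Lm_carrier = lower_unitriangularD(1)[OF Lm]
lemmas Mm_carrier = lower_unitriangularD(1)[OF Mm(1)]

lemma conj_iff:
  assumes "A \<in> carrier_mat n n"
  shows "A * Lm z = Lm z * Tm m z \<longleftrightarrow> A = Lm z * Tm m z * Mm z"
proof
  assume eq: "A * Lm z = Lm z * Tm m z"
  have "Lm z * Tm m z * Mm z = A * (Lm z * Mm z)"
    unfolding eq[symmetric] by (rule assoc_mult_mat[OF assms Lm_carrier Mm_carrier])
  then show "A = Lm z * Tm m z * Mm z" unfolding Mm by (simp only: right_mult_one_mat[OF assms])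
next
  assume eq: "A = Lm z * Tm m z * Mm z"
  have c: "Lm z * Tm m z \<in> carrier_mat n n" by (rule mult_carrier_mat[OF Lm_carrier Tm(1)])
  have "A * Lm z = Lm z * Tm m z * (Mm z * Lm z)"
    unfolding eq by (rule assoc_mult_mat[OF c Mm_carrier Lm_carrier])
  then show "A * Lm z = Lm z * Tm m z" unfolding Mm by (simp only: right_mult_one_mat[OF c])
qed

lemma conj_carrier: "Lm z * Tm m z * Mm z \<in> carrier_mat n n"
  by (intro mult_carrier_mat[of _ n n] Lm_carrier Tm Mm_carrier)

lemma conj_mult: "Lm z * Tm m z * Mm z * Lm z = Lm z * Tm m z"
  using conj_iff[OF conj_carrier] by blast

lemma conj_back: "Mm z * (Lm z * Tm m z * Mm z) * Lm z = Tm m z"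
proof -
  have c: "Lm z * Tm m z \<in> carrier_mat n n" by (rule mult_carrier_mat[OF Lm_carrier Tm(1)])
  have "Mm z * (Lm z * Tm m z * Mm z) * Lm z = Mm z * ((Lm z * Tm m z * Mm z) * Lm z)"
    by (rule assoc_mult_mat[OF Mm_carrier conj_carrier Lm_carrier])
  also have "(Lm z * Tm m z * Mm z) * Lm z = Lm z * Tm m z"
    by (rule conj_mult)
  also have "Mm z * (Lm z * Tm m z) = Mm z * Lm z * Tm m z"
    by (rule assoc_mult_mat[OF Mm_carrier Lm_carrier Tm(1), symmetric])
  also have "\<dots> = Tm m z" unfolding Mm by (rule left_mult_one_mat[OF Tm(1)])
  finally show ?thesis .
qed

lemma chart_in: "chart z \<in> pair_coords n ` simul_triang n"
proof -
  have "(Lm z * Tm 1 z * Mm z, Lm z * Tm 2 z * Mm z) \<in> simul_triang n"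
    unfolding simul_triang_def mem_Collect_eq prod.case
    by (intro conjI conj_carrier bexI[of _ "Mm z"] bexI[of _ "Lm z"] Mm_carrier Lm_carrier Mm(2,3))
      (simp_all only: conj_back Tm(2))
  then show ?thesis unfolding chart_def by blast
qed

lemma Tm_diag_qRe:
  assumes "z \<in> open_cube d" "i < n" "m = 1 \<or> m = 2"
  shows "real i < qRe (Tm m z $$ (i, i))" "qRe (Tm m z $$ (i, i)) < real i + 1"
proof -
  have "h (m, 0, i, i) < d" using assms by (intro h_less param_index_mem) auto
  then have "0 < z $ h (m, 0, i, i)" "z $ h (m, 0, i, i) < 1" using assms(1) by (auto simp: open_cube_def)
  moreover have "qRe (Tm m z $$ (i, i)) = real i + z $ h (m, 0, i, i)"
    using assms(2) by (simp add: Tm_def upper_entry_def qentry_def plus_quat_def)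
  ultimately show "real i < qRe (Tm m z $$ (i, i))" "qRe (Tm m z $$ (i, i)) < real i + 1" by auto
qed

lemma chart_inj: "inj_on chart (open_cube d)"
proof (rule inj_onI)
  fix x y assume x: "x \<in> open_cube d" and y: "y \<in> open_cube d" and "chart x = chart y"
  then have eq: "Lm x * Tm m x * Mm x = Lm y * Tm m y * Mm y" if "m = 1 \<or> m = 2" for m
    using inj_onD[OF bij_betw_imp_inj_on[OF pair_coords_bij], of n] conj_carrier that
    unfolding chart_def by blast
  \<comment> \<open>The change of basis between the two flags. It intertwines the triangular factors
    of \<open>x\<close> and \<open>y\<close>; once it is the identity, both the unitriangular and
    the triangular factors agree.\<close>
  define N where "N = Mm y * Lm x"
  have N: "lower_unitriangular n N" unfolding N_def by (rule lower_unitriangular_mult[OF Mm(1) Lm])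
  note Nc = lower_unitriangularD(1)[OF N]
  have NT: "N * Tm m x = Tm m y * N" if "m = 1 \<or> m = 2" for m
  proof -
    have c: "Lm y * Tm m y \<in> carrier_mat n n" by (rule mult_carrier_mat[OF Lm_carrier Tm(1)])
    have "N * Tm m x = Mm y * (Lm x * Tm m x)"
      unfolding N_def by (rule assoc_mult_mat[OF Mm_carrier Lm_carrier Tm(1)])
    also have "Lm x * Tm m x = Lm x * Tm m x * Mm x * Lm x"
      by (rule conj_mult[symmetric])
    also have "\<dots> = Lm y * Tm m y * Mm y * Lm x" unfolding eq[OF that] by (rule refl)
    also have "\<dots> = Lm y * Tm m y * N"
      unfolding N_def by (rule assoc_mult_mat[OF c Mm_carrier Lm_carrier])
    also have "\<dots> = Lm y * (Tm m y * N)" by (rule assoc_mult_mat[OF Lm_carrier Tm(1) Nc])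
    also have "Mm y * \<dots> = Mm y * Lm y * (Tm m y * N)"
      by (rule assoc_mult_mat[OF Mm_carrier Lm_carrier mult_carrier_mat[OF Tm(1) Nc], symmetric])
    also have "\<dots> = Tm m y * N"
      unfolding Mm by (rule left_mult_one_mat[OF mult_carrier_mat[OF Tm(1) Nc]])
    finally show ?thesis .
  qed
  have N1: "N = 1\<^sub>m n"
  proof (rule upper_triangular_intertwiner[OF N Tm Tm NT[of 1]])
    fix i j assume ij: "j < i" "i < n"
    \<comment> \<open>The shift separates the real parts: for \<open>j < i\<close> one lies below
      \<open>j + 1\<close>, the other above \<open>i\<close>.\<close>
    have "qRe (Tm 1 x $$ (j, j)) < real j + 1" "real i < qRe (Tm 1 y $$ (i, i))"
      using Tm_diag_qRe[OF x, of j 1] Tm_diag_qRe[OF y, of i 1] ij by auto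
    then show "qRe (Tm 1 x $$ (j, j)) \<noteq> qRe (Tm 1 y $$ (i, i))" using ij by auto
  qed simp
  have T_eq: "Tm m x = Tm m y" if "m = 1 \<or> m = 2" for m
    using NT[OF that] unfolding N1 left_mult_one_mat[OF Tm(1)] right_mult_one_mat[OF Tm(1)] .
  have "Lm y * N = Lm y * Mm y * Lm x"
    unfolding N_def by (rule assoc_mult_mat[OF Lm_carrier Mm_carrier Lm_carrier, symmetric])
  then have L_eq: "Lm y = Lm x"
    unfolding N1 Mm left_mult_one_mat[OF Lm_carrier] right_mult_one_mat[OF Lm_carrier] .
  have "x $ h p = y $ h p" if "p \<in> param_index n" for p
  proof -
    from that consider i j c where "p = (0, i, j, c)" "j < i" "i < n" "c < 4"
      | m c j i where "p = (m, c, j, i)" "m = 1 \<or> m = 2" "c < 4" "i \<le> j" "j < n"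
      by (auto simp: param_index_def)
    then show ?thesis
    proof cases
      case 1
      have "Lm x $$ (i, j) = Lm y $$ (i, j)" unfolding L_eq by (rule refl)
      then have "qentry x (\<lambda>c. h (0, i, j, c)) = qentry y (\<lambda>c. h (0, i, j, c))"
        using 1 by (simp add: Lm_def lower_entry_def)
      from qentry_eqD[OF this] 1 show ?thesis by simp
    next
      case 2
      have "Tm m x $$ (i, j) = Tm m y $$ (i, j)" unfolding T_eq[OF 2(2)] by (rule refl)
      then have "qentry x (\<lambda>c. h (m, c, j, i)) = qentry y (\<lambda>c. h (m, c, j, i))"
        using 2 by (simp add: Tm_def upper_entry_def)
      from qentry_eqD[OF this] 2 show ?thesis by simp
    qed
  qed
  then have "x $ k = y $ k" if "k < d" for k
    using h that by (metis atLeastLessThan_iff bij_betw_imp_surj_on imageE le0)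
  moreover have "dim_vec x = d" "dim_vec y = d" using x y by (auto simp: open_cube_def)
  ultimately show "x = y" by (intro eq_vecI) auto
qed

text \<open>An entry of \<open>A L - L T\<close>, where the coordinates of \<open>A\<close> start at
  position \<open>off\<close> of \<open>z\<close>. Written in this way, the condition that
  \<open>A\<close> is the conjugate of \<open>T\<close> by \<open>L\<close> is polynomial in
  \<open>z\<close> without any formula for the inverse of \<open>L\<close>.\<close>

definition conj_defect :: "nat \<Rightarrow> nat \<Rightarrow> real vec \<Rightarrow> nat \<Rightarrow> nat \<Rightarrow> quat" where
  "conj_defect off m z i j =
     (\<Sum>k<n. qentry z (\<lambda>c. off + (4 * (i * n + k) + c)) * lower_entry h z k j) -
     (\<Sum>k<n. lower_entry h z i k * upper_entry h m z k j)"

lemma conj_defect_poly: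
  assumes "off + 4 * n\<^sup>2 \<le> D" "d \<le> D" "i < n" "j < n" "m = 1 \<or> m = 2"
  shows "quat_poly D (\<lambda>z. conj_defect off m z i j)"
proof -
  have low: "quat_poly D (\<lambda>z. lower_entry h z i j)" if "i < n" for i j
  proof (cases "j < i")
    case True
    have "h (0, i, j, c) < D" if "c < 4" for c
      using h_less[OF param_index_mem(1)[OF True \<open>i < n\<close> that]] assms(2) by linarith
    then show ?thesis using True by (simp add: lower_entry_def quat_poly_qentry)
  next
    case False
    then show ?thesis by (cases "i = j") (simp_all add: lower_entry_def quat_poly_const)
  qed
  have upp: "quat_poly D (\<lambda>z. upper_entry h m z i j)" if "j < n" for i j
  proof (cases "i \<le> j")
    case True
    have "h (m, c, j, i) < D" if "c < 4" for c
      using h_less[OF param_index_mem(2)[OF True \<open>j < n\<close> that assms(5)]] assms(2) by linarith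
    then show ?thesis using True
      by (auto simp: upper_entry_def intro!: quat_poly_add quat_poly_qentry quat_poly_const)
  qed (simp add: upper_entry_def quat_poly_const)
  have ent: "quat_poly D (\<lambda>z. qentry z (\<lambda>c. off + (4 * (i * n + k) + c)))" if "k < n" for k
    using mat_coords_index(1)[OF assms(3) that] assms(1) by (intro quat_poly_qentry) fastforce
  show ?thesis unfolding conj_defect_def
    by (intro quat_poly_diff quat_poly_sum quat_poly_mult low upp ent) (use assms in auto)
qed

lemma entries_append:
  assumes "x \<in> carrier_vec d"
  shows "j < n \<Longrightarrow> i < n \<Longrightarrow> lower_entry h (x @\<^sub>v y) i j = Lm x $$ (i, j)"
    "j < n \<Longrightarrow> i < n \<Longrightarrow> m = 1 \<or> m = 2 \<Longrightarrow> upper_entry h m (x @\<^sub>v y) i j = Tm m x $$ (i, j)"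
proof -
  have app: "(x @\<^sub>v y) $ h p = x $ h p" if "p \<in> param_index n" for p
    using h_less[OF that] assms by simp
  show "lower_entry h (x @\<^sub>v y) i j = Lm x $$ (i, j)" if "j < n" "i < n"
    using that by (auto simp: Lm_def lower_entry_def intro!: qentry_cong app param_index_mem)
  show "upper_entry h m (x @\<^sub>v y) i j = Tm m x $$ (i, j)" if "j < n" "i < n" "m = 1 \<or> m = 2"
    using that(1,2) by (auto simp: Tm_def upper_entry_def intro!: qentry_cong app param_index_mem that(3))
qed

lemma conj_defect_iff:
  assumes x: "x \<in> carrier_vec d" and m: "m = 1 \<or> m = 2" and A: "A \<in> carrier_mat n n"
    and ent: "\<And>k. k < 4 * n\<^sup>2 \<Longrightarrow> (x @\<^sub>v y) $ (off + k) = mat_coords n A $ k"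
  shows "(\<forall>i<n. \<forall>j<n. conj_defect off m (x @\<^sub>v y) i j = 0) \<longleftrightarrow> A = Lm x * Tm m x * Mm x"
proof -
  have "conj_defect off m (x @\<^sub>v y) i j = 0 \<longleftrightarrow> (A * Lm x) $$ (i, j) = (Lm x * Tm m x) $$ (i, j)"
    if ij: "i < n" "j < n" for i j
  proof -
    have "qentry (x @\<^sub>v y) (\<lambda>c. off + (4 * (i * n + k) + c)) = A $$ (i, k)" if "k < n" for k
      unfolding qentry_mat_coords[OF ij(1) that, symmetric]
      by (rule qentry_cong) (intro ent mat_coords_index(1) ij that)
    then show ?thesis unfolding conj_defect_def
      times_mat_entry[OF A Lm_carrier ij] times_mat_entry[OF Lm_carrier Tm(1) ij]
      using entries_append[OF x, where y = y] ij m by simp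
  qed
  then have "(\<forall>i<n. \<forall>j<n. conj_defect off m (x @\<^sub>v y) i j = 0) \<longleftrightarrow>
      (\<forall>i<n. \<forall>j<n. (A * Lm x) $$ (i, j) = (Lm x * Tm m x) $$ (i, j))" by simp
  also have "\<dots> \<longleftrightarrow> A * Lm x = Lm x * Tm m x"
  proof
    assume eq: "\<forall>i<n. \<forall>j<n. (A * Lm x) $$ (i, j) = (Lm x * Tm m x) $$ (i, j)"
    show "A * Lm x = Lm x * Tm m x"
      by (rule eq_matI)
        (use eq A Lm_carrier[of x] Tm(1)[of m x] in \<open>simp_all del: index_mult_mat(1)\<close>)
  next
    assume eq: "A * Lm x = Lm x * Tm m x"
    show "\<forall>i<n. \<forall>j<n. (A * Lm x) $$ (i, j) = (Lm x * Tm m x) $$ (i, j)"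
      unfolding eq by blast
  qed
  finally show ?thesis using conj_iff[OF A] by simp
qed

text \<open>After the \<open>d\<close> coordinates of the point, those of the first matrix begin at
  \<open>d\<close> and those of the second at \<open>d + 4 * n\<^sup>2\<close>.\<close>

lemma graph_chart:
  "(\<lambda>x. x @\<^sub>v chart x) ` open_cube d = {z \<in> carrier_vec (d + 8 * n\<^sup>2).
     (\<forall>k\<in>{..<d}. 0 < z $ k \<and> 0 < 1 - z $ k) \<and>
     (\<forall>(i, j)\<in>{..<n} \<times> {..<n}. conj_defect d 1 z i j = 0) \<and>
     (\<forall>(i, j)\<in>{..<n} \<times> {..<n}. conj_defect (d + 4 * n\<^sup>2) 2 z i j = 0)}" (is "?G = ?R")
proof -
  have chart_iff: "(\<forall>(i, j)\<in>{..<n} \<times> {..<n}. conj_defect d 1 (x @\<^sub>v y) i j = 0) \<and>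
     (\<forall>(i, j)\<in>{..<n} \<times> {..<n}. conj_defect (d + 4 * n\<^sup>2) 2 (x @\<^sub>v y) i j = 0) \<longleftrightarrow> y = chart x"
    if x: "x \<in> carrier_vec d" and y: "y \<in> carrier_vec (8 * n\<^sup>2)" for x y
  proof -
    have "y \<in> pair_coords n ` (carrier_mat n n \<times> carrier_mat n n)"
      using y bij_betw_imp_surj_on[OF pair_coords_bij] by blast
    then obtain A B where AB: "y = pair_coords n (A, B)" "A \<in> carrier_mat n n" "B \<in> carrier_mat n n"
      by blast
    have y_eq: "y = mat_coords n A @\<^sub>v mat_coords n B" by (simp add: AB pair_coords_def)
    have dims: "dim_vec (mat_coords n A) = 4 * n\<^sup>2" "dim_vec (mat_coords n B) = 4 * n\<^sup>2" "dim_vec x = d"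
      using x by (auto simp: mat_coords_def)
    have "(x @\<^sub>v y) $ (d + k) = mat_coords n A $ k" if "k < 4 * n\<^sup>2" for k
      using that dims by (simp add: y_eq)
    note A = conj_defect_iff[OF x _ AB(2) this, of 1]
    have "(x @\<^sub>v y) $ (d + 4 * n\<^sup>2 + k) = mat_coords n B $ k" if "k < 4 * n\<^sup>2" for k
      using that dims by (simp add: y_eq)
    note B = conj_defect_iff[OF x _ AB(3) this, of 2]
    have "y = chart x \<longleftrightarrow> (A, B) = (Lm x * Tm 1 x * Mm x, Lm x * Tm 2 x * Mm x)"
      unfolding AB(1) chart_def
      by (rule inj_on_eq_iff[OF bij_betw_imp_inj_on[OF pair_coords_bij]])
        (use AB conj_carrier in auto)
    then show ?thesis using A B by auto
  qed
  have chart_carrier: "chart x \<in> carrier_vec (8 * n\<^sup>2)" for x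
    unfolding chart_def using conj_carrier bij_betw_apply[OF pair_coords_bij] by blast
  show ?thesis
  proof (intro equalityI subsetI)
    fix z assume "z \<in> ?G"
    then obtain x where x: "x \<in> open_cube d" and z: "z = x @\<^sub>v chart x" by blast
    then have xc: "x \<in> carrier_vec d" by (simp add: open_cube_def)
    have "\<forall>k\<in>{..<d}. 0 < z $ k \<and> 0 < 1 - z $ k" using x xc by (auto simp: z open_cube_def)
    moreover have "z \<in> carrier_vec (d + 8 * n\<^sup>2)"
      unfolding z by (rule append_carrier_vec[OF xc chart_carrier])
    ultimately show "z \<in> ?R" using chart_iff[OF xc chart_carrier[of x]] unfolding z by blast
  next
    fix z assume z: "z \<in> ?R"
    define x y where "x = vec_first z d" and "y = vec_last z (8 * n\<^sup>2)"
    have x: "x \<in> carrier_vec d" and y: "y \<in> carrier_vec (8 * n\<^sup>2)" by (simp_all add: x_def y_def)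
    have z_eq: "z = x @\<^sub>v y" unfolding x_def y_def using z by (intro vec_first_last_append[symmetric]) auto
    have "y = chart x" using z chart_iff[OF x y] unfolding z_eq by blast
    moreover have "x $ k = z $ k" if "k < d" for k using that x by (simp add: z_eq)
    then have "x \<in> open_cube d" using z x by (auto simp: open_cube_def)
    ultimately show "z \<in> ?G" unfolding z_eq by blast
  qed
qed

lemma chart_semialgebraic:
  "semialgebraic_map d (8 * n\<^sup>2) (open_cube d) (pair_coords n ` simul_triang n) chart"
proof -
  have "simul_triang n \<subseteq> carrier_mat n n \<times> carrier_mat n n" by (auto simp: simul_triang_def)
  then have sub: "pair_coords n ` simul_triang n \<subseteq> carrier_vec (8 * n\<^sup>2)"
    using bij_betw_imp_surj_on[OF pair_coords_bij[of n]] by blast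
  have defect: "semialgebraic (d + 8 * n\<^sup>2) {z \<in> carrier_vec (d + 8 * n\<^sup>2).
      \<forall>(i, j)\<in>{..<n} \<times> {..<n}. conj_defect off m z i j = 0}"
    if "off + 4 * n\<^sup>2 \<le> d + 8 * n\<^sup>2" "m = 1 \<or> m = 2" for off m
    using that by (intro semialgebraic_Ball) (auto intro!: semialgebraic_quat_zero conj_defect_poly)
  have "semialgebraic (d + 8 * n\<^sup>2) ((\<lambda>x. x @\<^sub>v chart x) ` open_cube d)"
    unfolding graph_chart
    by (intro semialgebraic_conj semialgebraic_Ball defect semialgebraic.pos poly_fun_diff
        poly_fun.const poly_fun.coord) auto
  moreover have "open_cube d \<subseteq> carrier_vec d" by (auto simp: open_cube_def)
  ultimately show ?thesis using sub chart_in unfolding semialgebraic_map_def by blast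
qed

end

theorem corollary6p6:
  fixes n :: nat
  assumes "n \<ge> 1"
  shows "semialgebraic_dim (8 * n\<^sup>2) (pair_coords n ` simul_triang n) =
    int (2 * n * (3 * n + 1))"
proof -
  define d where "d = 2 * n * (3 * n + 1)"
  let ?S = "pair_coords n ` simul_triang n"
  let ?D = "{d. \<exists>f. semialgebraic_map d (8 * n\<^sup>2) (open_cube d) ?S f \<and> inj_on f (open_cube d)}"
  obtain h where "bij_betw h (param_index n) {0..<d}"
    using ex_bij_betw_finite_nat[OF card_param_index(1)] by (auto simp: card_param_index d_def)
  then interpret triangular_chart n d h by unfold_locales
  have "d \<in> ?D" using chart_semialgebraic chart_inj by blast
  moreover have upper: "k \<le> d" if "k \<in> ?D" for k
    using that semialgebraic_injection_dim_le simul_triang_param unfolding d_def by blast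
  \<comment> \<open>The bound must come before the maximum, since \<open>Max\<close> is meaningful
    only for finite nonempty sets.\<close>
  then have "finite ?D" by (meson finite_nat_set_iff_bounded_le)
  ultimately have "Max ?D = d" using upper by (intro Max_eqI) auto
  moreover have "?S \<noteq> {}" using chart_in by blast
  ultimately show ?thesis by (simp add: semialgebraic_dim_def d_def)
qed

end
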